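(* The operator $$\tilde{\mathcal D}=\begin{pmatrix}0&0&0&1\\0&0&1&0\\0&-1&0&0\\-1&0&0&0\end{pmatrix}$$ is Hamiltonian; that is, the bracket $$\{F,G\}_{\tilde{\mathcal D}}=\int(\partial F)^{\intercal}\,\tilde{\mathcal D}\,\partial G\,dt$$ on functionals $F,G$ of $(q,r,p,s)$ is skew-symmetric and satisfies the Jacobi identity.
   Context: Formal (algebraic) framework of the calculus of variations: $q,r,p,s$ are smooth complex-valued functions of $t$; functionals are of the form $F[q,r,p,s]=\int f\,dt$, where $f$ is a differential function, i.e. a smooth function of $t,q,r,p,s$ and finitely many $t$-derivatives of $q,r,p,s$. All functions can be differentiated to any order and integrations by parts produce no boundary terms. The gradient $\partial F=(\partial_1F,\partial_2F,\partial_3F,\partial_4F)^{\intercal}$ consists of the variational derivatives of $F$ with respect to $q,r,p,s$: $\frac{d}{d\epsilon}F[(q,r,p,s)+\epsilon\varphi]\big|_{\epsilon=0}=\int\sum_{j=1}^4(\partial_jF)\varphi_j\,dt$ for all smooth compactly supported $\varphi=(\varphi_1,\dots,\varphi_4)$. An operator is called Hamiltonian if its associated bracket is skew-symmetric and satisfies the Jacobi identity $\{\{F,G\},H\}+\{\{G,H\},F\}+\{\{H,F\},G\}=0$ for all functionals $F,G,H$. *)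

theory Defs
  imports "HOL-Analysis.Analysis"
begin

text \<open>
  The four dependent variables \<open>q, r, p, s\<close> are the components \<open>1, 2, 3, 4\<close> of a curve
  \<open>real \<Rightarrow> complex ^ 4\<close>. A jet \<open>(t, z)\<close> carries the time \<open>t\<close> and, for each order \<open>k\<close>, the value
  \<open>z k\<close> of the \<open>k\<close>-th \<open>t\<close>-derivative of \<open>(q, r, p, s)\<close>.
\<close>

type_synonym jet = "real \<times> (nat \<Rightarrow> complex ^ 4)"

definition time_deriv :: "(real \<Rightarrow> complex ^ 4) \<Rightarrow> real \<Rightarrow> complex ^ 4" where
  "time_deriv u = (\<lambda>t. vector_derivative u (at t))"

definition smooth_curve :: "(real \<Rightarrow> complex ^ 4) \<Rightarrow> bool" where
  "smooth_curve u \<longleftrightarrow> (\<forall>k t. (time_deriv ^^ k) u differentiable (at t))"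

definition prolong :: "(real \<Rightarrow> complex ^ 4) \<Rightarrow> real \<Rightarrow> jet" where
  "prolong u t = (t, \<lambda>k. (time_deriv ^^ k) u t)"


text \<open>
  Smoothness on the jet space is meant in the real sense: all iterated directional derivatives,
  along directions \<open>(\<tau>, w)\<close> with \<open>w\<close> a sequence of complex vectors (so including the partial
  derivatives with respect to real and imaginary parts), exist and are continuous. Continuity
  refers to the product topology; for functions depending on finitely many \<open>z k\<close> only, this is
  ordinary continuity in those finitely many variables.
\<close>

primrec C_k :: "nat \<Rightarrow> (jet \<Rightarrow> complex) \<Rightarrow> bool" where
  "C_k 0 f \<longleftrightarrow> continuous_on UNIV f"
| "C_k (Suc n) f \<longleftrightarrow> continuous_on UNIV f \<and>
     (\<forall>\<tau> w. \<exists>g. C_k n g \<and>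
        (\<forall>t z. ((\<lambda>h. f (t + h * \<tau>, \<lambda>k. z k + h *\<^sub>R w k)) has_vector_derivative g (t, z)) (at 0)))"

definition differential_function :: "(jet \<Rightarrow> complex) \<Rightarrow> bool" where
  "differential_function f \<longleftrightarrow>
     (\<exists>N. \<forall>t z z'. (\<forall>k\<le>N. z k = z' k) \<longrightarrow> f (t, z) = f (t, z')) \<and> (\<forall>n. C_k n f)"


text \<open>
  Since integrations by parts produce no boundary terms, densities differing by the total
  \<open>t\<close>-derivative of a differential function have the same integral. The functional
  \<open>\<integral>f dt\<close> is the class of \<open>f\<close> modulo such total derivatives.
\<close>

definition total_derivative :: "(jet \<Rightarrow> complex) \<Rightarrow> bool" where
  "total_derivative f \<longleftrightarrow>
     (\<exists>h. differential_function h \<and>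
        (\<forall>u. smooth_curve u \<longrightarrow>
           (\<forall>t. ((\<lambda>t'. h (prolong u t')) has_vector_derivative f (prolong u t)) (at t))))"

definition functional_of :: "(jet \<Rightarrow> complex) \<Rightarrow> (jet \<Rightarrow> complex) set" where
  "functional_of f = {g. differential_function g \<and> total_derivative (\<lambda>x. g x - f x)}"

definition functional_add ::
  "(jet \<Rightarrow> complex) set \<Rightarrow> (jet \<Rightarrow> complex) set \<Rightarrow> (jet \<Rightarrow> complex) set"  (infixl "\<oplus>\<^sub>F" 65) where
  "F \<oplus>\<^sub>F G = {\<lambda>x. f x + g x | f g. f \<in> F \<and> g \<in> G}"

definition functional_neg :: "(jet \<Rightarrow> complex) set \<Rightarrow> (jet \<Rightarrow> complex) set" where
  "functional_neg F = {\<lambda>x. - f x | f. f \<in> F}"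

definition functional_zero :: "(jet \<Rightarrow> complex) set" where
  "functional_zero = functional_of (\<lambda>x. 0)"


definition test_curve :: "(real \<Rightarrow> complex ^ 4) \<Rightarrow> bool" where
  "test_curve \<phi> \<longleftrightarrow> smooth_curve \<phi> \<and> (\<exists>a b. \<forall>t. t \<notin> {a..b} \<longrightarrow> \<phi> t = 0)"

text \<open>
  \<open>P\<close> consists of the variational derivatives of \<open>\<integral>f dt\<close>. The integral of \<open>f\<close> along \<open>u\<close> may
  diverge; subtracting this constant, which does not affect the \<open>\<epsilon>\<close>-derivative, leaves an
  integrand of compact support. The variations \<open>\<phi>\<close> are complex-valued while \<open>\<epsilon>\<close> is real, so
  having such a \<open>P\<close> forces the first variation to be complex-linear: a density like
  \<open>q * cnj q\<close> has none.
\<close>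

definition has_gradient :: "(jet \<Rightarrow> complex) \<Rightarrow> (jet \<Rightarrow> complex ^ 4) \<Rightarrow> bool" where
  "has_gradient f P \<longleftrightarrow>
     (\<forall>j. differential_function (\<lambda>x. P x $ j)) \<and>
     (\<forall>u \<phi>. smooth_curve u \<longrightarrow> test_curve \<phi> \<longrightarrow>
        ((\<lambda>\<epsilon>. integral UNIV
                (\<lambda>t. f (prolong (\<lambda>t'. u t' + \<epsilon> *\<^sub>R \<phi> t') t) - f (prolong u t)))
           has_vector_derivative
             integral UNIV (\<lambda>t. \<Sum>j\<in>UNIV. P (prolong u t) $ j * \<phi> t $ j)) (at 0))"

definition functionals :: "(jet \<Rightarrow> complex) set set" where
  "functionals = {functional_of f | f. differential_function f \<and> (\<exists>P. has_gradient f P)}"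

text \<open>
  The gradient is unique, and the same for all densities of \<open>F\<close>, by the fundamental lemma of the
  calculus of variations and because every finite jet is attained by a smooth curve.
\<close>

definition gradient :: "(jet \<Rightarrow> complex) set \<Rightarrow> jet \<Rightarrow> complex ^ 4" where
  "gradient F = (THE P. \<exists>f\<in>F. has_gradient f P)"


definition bracket ::
  "((jet \<Rightarrow> complex ^ 4) \<Rightarrow> jet \<Rightarrow> complex ^ 4) \<Rightarrow>
     (jet \<Rightarrow> complex) set \<Rightarrow> (jet \<Rightarrow> complex) set \<Rightarrow> (jet \<Rightarrow> complex) set" where
  "bracket D F G = functional_of (\<lambda>x. \<Sum>j\<in>UNIV. gradient F x $ j * D (gradient G) x $ j)"

text \<open>
  The first clause, that the bracket of two functionals is again a functional (with a gradient),
  makes the iterated brackets in the Jacobi identity meaningful.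
\<close>

definition hamiltonian :: "((jet \<Rightarrow> complex ^ 4) \<Rightarrow> jet \<Rightarrow> complex ^ 4) \<Rightarrow> bool" where
  "hamiltonian D \<longleftrightarrow>
     (\<forall>F\<in>functionals. \<forall>G\<in>functionals. bracket D F G \<in> functionals) \<and>
     (\<forall>F\<in>functionals. \<forall>G\<in>functionals. bracket D F G = functional_neg (bracket D G F)) \<and>
     (\<forall>F\<in>functionals. \<forall>G\<in>functionals. \<forall>H\<in>functionals.
        bracket D (bracket D F G) H \<oplus>\<^sub>F bracket D (bracket D G H) F \<oplus>\<^sub>F bracket D (bracket D H F) G
          = functional_zero)"

definition D_tilde :: "complex ^ 4 ^ 4" where
  "D_tilde = vector [vector [ 0,  0, 0, 1],
                     vector [ 0,  0, 1, 0],
                     vector [ 0, -1, 0, 0],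
                     vector [-1,  0, 0, 0]]"

end

theory Submission
  imports Defs
begin

text \<open>
  The matrix is constant and skew-symmetric, and every such operator \<open>M\<close> is Hamiltonian. Write
  \<open>P, Q, S\<close> for the gradients of \<open>F, G, H\<close>, \<open>P'[\<alpha>]\<close> for the derivative of \<open>P\<close> in the direction of the
  prolongation of \<open>\<alpha>\<close>, and \<open>\<cdot>\<close> for the complex-bilinear pairing. Skew-symmetry of the bracket is that
  of \<open>M\<close>. The Jacobi identity rests on one property of gradients, the self-adjointness of their
  linearization, which expresses the symmetry of second variations.

  In weak form (\<open>gradient_self_adjoint\<close>) it says that \<open>P'[\<phi>] \<cdot> \<psi>\<close> and \<open>P'[\<psi>] \<cdot> \<phi>\<close> have the same
  integral along every curve if \<open>\<phi>\<close> is a test curve. It is derived by varying the defining identity of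
  the gradient once more and exchanging the two derivatives of the density. Applied with
  \<open>\<psi> = M Q\<close> and \<open>\<psi> = M P\<close>, it shows that the bracket has the gradient \<open>P'[M Q] - Q'[M P]\<close>
  (\<open>bracket_density_gradient\<close>); in particular the bracket of two functionals is a functional.

  In strong form (\<open>self_adjoint_total_derivative\<close>) it says that \<open>P'[\<alpha>] \<cdot> \<beta> - P'[\<beta>] \<cdot> \<alpha>\<close> is a total
  derivative for all differential vectors \<open>\<alpha>\<close> and \<open>\<beta>\<close>. Indeed, formal integration by parts turns
  \<open>P'[\<alpha>] \<cdot> \<beta>\<close> into the pairing of \<open>\<alpha>\<close> with the formal adjoint of \<open>P'\<close> applied to \<open>\<beta>\<close>, and by the
  weak form, the fundamental lemma of the calculus of variations and the fact that every finite jet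
  lies on a smooth curve, the formal adjoint is \<open>P'\<close> itself.

  The density of the Jacobi sum is
  \<open>(P'[M Q] - Q'[M P]) \<cdot> M S + (Q'[M S] - S'[M Q]) \<cdot> M P + (S'[M P] - P'[M S]) \<cdot> M Q\<close>.
  Collecting the terms with \<open>P'\<close>, with \<open>Q'\<close> and with \<open>S'\<close> leaves three expressions of the form just
  considered, so the sum is a total derivative and represents the zero functional.

  The analytic groundwork consists of a chain rule on the jet space, which is infinite-dimensional
  but of which each differential function sees finitely many coordinates (\<open>chain_rule_expanded\<close>),
  differentiation under the integral sign (\<open>first_variation\<close>), and smooth bump and cutoff functions.
\<close>


section \<open>Smooth functions of one real variable\<close>

text \<open>
  The recursion asks for a derivative instead of iterating a derivative operator, so that closure
  properties (sums, products, reciprocals) follow by induction on the order.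
\<close>

primrec ndiff :: "nat \<Rightarrow> (real \<Rightarrow> 'a::real_normed_vector) \<Rightarrow> bool" where
  "ndiff 0 u \<longleftrightarrow> True"
| "ndiff (Suc n) u \<longleftrightarrow> (\<exists>u'. (\<forall>t. (u has_vector_derivative u' t) (at t)) \<and> ndiff n u')"

definition smooth :: "(real \<Rightarrow> 'a::real_normed_vector) \<Rightarrow> bool" where
  "smooth u \<longleftrightarrow> (\<forall>n. ndiff n u)"

lemma ndiff_SucI:
  "(\<And>t. (u has_vector_derivative u' t) (at t)) \<Longrightarrow> ndiff n u' \<Longrightarrow> ndiff (Suc n) u"
  by auto

lemma ndiff_SucD: "ndiff (Suc n) u \<Longrightarrow> ndiff n u"
proof (induction n arbitrary: u)
  case (Suc n)
  from Suc.prems obtain u' where "\<And>t. (u has_vector_derivative u' t) (at t)" "ndiff (Suc n) u'"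
    unfolding ndiff.simps(2)[of "Suc n" u] by blast
  then show ?case
    using Suc.IH by (intro ndiff_SucI)
qed simp

lemma ndiff_const: "ndiff n (\<lambda>t. c)"
  by (induction n arbitrary: c) (auto intro!: exI[of _ "\<lambda>t. 0"] derivative_eq_intros)

lemma ndiff_add: "ndiff n u \<Longrightarrow> ndiff n v \<Longrightarrow> ndiff n (\<lambda>t. u t + v t)"
proof (induction n arbitrary: u v)
  case (Suc n)
  then obtain u' v' where "\<And>t. (u has_vector_derivative u' t) (at t)" "ndiff n u'"
    "\<And>t. (v has_vector_derivative v' t) (at t)" "ndiff n v'"
    by auto
  then show ?case
    using Suc.IH by (intro ndiff_SucI[where u'="\<lambda>t. u' t + v' t"] has_vector_derivative_add) auto
qed simp

lemma ndiff_linear: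
  assumes T: "bounded_linear T"
  shows "ndiff n u \<Longrightarrow> ndiff n (\<lambda>t. T (u t))"
proof (induction n arbitrary: u)
  case (Suc n)
  then obtain u' where "\<And>t. (u has_vector_derivative u' t) (at t)" "ndiff n u'"
    by auto
  then show ?case
    using Suc.IH
    by (intro ndiff_SucI[where u'="\<lambda>t. T (u' t)"] bounded_linear.has_vector_derivative[OF T]) auto
qed simp

lemma ndiff_bilinear:
  assumes B: "bounded_bilinear m"
  shows "ndiff n u \<Longrightarrow> ndiff n v \<Longrightarrow> ndiff n (\<lambda>t. m (u t) (v t))"
proof (induction n arbitrary: u v)
  case (Suc n)
  then obtain u' v' where *: "\<And>t. (u has_vector_derivative u' t) (at t)" "ndiff n u'"
    "\<And>t. (v has_vector_derivative v' t) (at t)" "ndiff n v'"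
    by auto
  show ?case
    using * Suc.prems[THEN ndiff_SucD] Suc.IH
    by (intro ndiff_SucI[where u'="\<lambda>t. m (u t) (v' t) + m (u' t) (v t)"]
        bounded_bilinear.has_vector_derivative[OF B] ndiff_add) auto
qed simp

lemma ndiff_affine: "ndiff n u \<Longrightarrow> ndiff n (\<lambda>t. u (c * t + d))"
proof (induction n arbitrary: u)
  case (Suc n)
  then obtain u' where u': "\<And>t. (u has_vector_derivative u' t) (at t)" "ndiff n u'"
    by auto
  have "((\<lambda>t. u (c * t + d)) has_vector_derivative c *\<^sub>R u' (c * t + d)) (at t)" for t
  proof -
    have "((\<lambda>t. c * t + d) has_vector_derivative c) (at t)"
      by (auto intro!: derivative_eq_intros simp flip: has_real_derivative_iff_has_vector_derivative)
    from vector_diff_chain_at[OF this u'(1)] show ?thesis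
      by (simp add: o_def)
  qed
  moreover have "ndiff n (\<lambda>t. c *\<^sub>R u' (c * t + d))"
    by (rule ndiff_linear[OF bounded_linear_scaleR_right]) (rule Suc.IH[OF u'(2)])
  ultimately show ?case
    by (rule ndiff_SucI)
qed simp

lemma ndiff_inverse:
  fixes u :: "real \<Rightarrow> real"
  assumes nz: "\<And>t. u t \<noteq> 0"
  shows "ndiff n u \<Longrightarrow> ndiff n (\<lambda>t. inverse (u t))"
proof (induction n)
  case (Suc n)
  then obtain u' where u': "\<And>t. (u has_vector_derivative u' t) (at t)" "ndiff n u'"
    by auto
  have "((\<lambda>t. inverse (u t)) has_vector_derivative (- 1) * (u' t * (inverse (u t) * inverse (u t)))) (at t)" for t
    using u'(1)[of t] nz[of t] unfolding has_real_derivative_iff_has_vector_derivative[symmetric]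
    by (auto intro!: derivative_eq_intros simp: power2_eq_square)
  moreover have "ndiff n (\<lambda>t. inverse (u t))"
    using Suc ndiff_SucD by blast
  with u'(2) have "ndiff n (\<lambda>t. (- 1) * (u' t * (inverse (u t) * inverse (u t))))"
    by (intro ndiff_bilinear[OF bounded_bilinear_mult] ndiff_const)
  ultimately show ?case
    by (rule ndiff_SucI)
qed simp

lemma smooth_const: "smooth (\<lambda>t. c)"
  and smooth_add: "smooth u \<Longrightarrow> smooth v \<Longrightarrow> smooth (\<lambda>t. u t + v t)"
  and smooth_linear: "bounded_linear T \<Longrightarrow> smooth u \<Longrightarrow> smooth (\<lambda>t. T (u t))"
  and smooth_affine: "smooth u \<Longrightarrow> smooth (\<lambda>t. u (a * t + d))"
  and smooth_inverse: "smooth r \<Longrightarrow> (\<And>t. r t \<noteq> (0::real)) \<Longrightarrow> smooth (\<lambda>t. inverse (r t))"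
  unfolding smooth_def
  by (blast intro: ndiff_const ndiff_add ndiff_linear ndiff_affine ndiff_inverse)+

lemma smooth_bilinear:
  "bounded_bilinear m \<Longrightarrow> smooth u \<Longrightarrow> smooth v \<Longrightarrow> smooth (\<lambda>t. m (u t) (v t))"
  unfolding smooth_def by (blast intro: ndiff_bilinear)

lemma smooth_has_derivative: "smooth u \<Longrightarrow> \<exists>u'. \<forall>t. (u has_vector_derivative u' t) (at t)"
  unfolding smooth_def using ndiff.simps(2)[of 0 u] by auto

lemma smooth_continuous_on: "smooth u \<Longrightarrow> continuous_on S u"
  using smooth_has_derivative
  by (metis continuous_at_imp_continuous_on has_vector_derivative_continuous)

lemma smooth_time_deriv:
  assumes "smooth u"
  shows "(u has_vector_derivative time_deriv u t) (at t)" and "smooth (time_deriv u)"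
proof -
  have d: "(u has_vector_derivative time_deriv u t) (at t)" for t
    using smooth_has_derivative[OF assms]
    by (auto simp: time_deriv_def intro: vector_derivative_at[THEN ssubst])
  have "ndiff n (time_deriv u)" for n
  proof -
    from assms have "ndiff (Suc n) u" unfolding smooth_def by blast
    then obtain u' where "\<And>t. (u has_vector_derivative u' t) (at t)" "ndiff n u'"
      by auto
    moreover from this(1) d have "u' = time_deriv u"
      by (auto intro: vector_derivative_unique_at)
    ultimately show ?thesis by simp
  qed
  then show "(u has_vector_derivative time_deriv u t) (at t)" "smooth (time_deriv u)"
    using d by (auto simp: smooth_def)
qed

lemma smooth_time_deriv_funpow: "smooth u \<Longrightarrow> smooth ((time_deriv ^^ k) u)"
  by (induction k) (auto simp: smooth_time_deriv)

lemma time_deriv_funpow_has_derivative: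
  "smooth u \<Longrightarrow> ((time_deriv ^^ k) u has_vector_derivative (time_deriv ^^ Suc k) u t) (at t)"
  using smooth_time_deriv(1)[OF smooth_time_deriv_funpow] by simp

text \<open>
  To identify the iterated derivatives of a concrete curve it is enough to exhibit a sequence of
  functions in which each is the derivative of the preceding one.
\<close>

lemma derivative_family_unique:
  assumes "\<And>k t. (U k has_vector_derivative U (Suc k) t) (at t)"
  shows "(time_deriv ^^ k) (U 0) = U k"
proof (induction k)
  case (Suc k)
  then show ?case
    using assms[THEN vector_derivative_at] by (auto simp: time_deriv_def)
qed simp

lemma derivative_family_smooth:
  assumes "\<And>k t. (U k has_vector_derivative U (Suc k) t) (at t)"
  shows "smooth (U k)"
proof -
  have "ndiff n (U k)" for n k
    by (induction n arbitrary: k) (use assms in auto)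
  then show ?thesis by (simp add: smooth_def)
qed

lemma smooth_curve_iff_smooth: "smooth_curve u \<longleftrightarrow> smooth u"
proof
  assume "smooth_curve u"
  then have "((time_deriv ^^ k) u has_vector_derivative (time_deriv ^^ Suc k) u t) (at t)" for k t
    by (auto simp: smooth_curve_def time_deriv_def vector_derivative_works)
  from derivative_family_smooth[of "\<lambda>k. (time_deriv ^^ k) u", OF this, of 0] show "smooth u"
    by simp
next
  assume "smooth u"
  then show "smooth_curve u"
    unfolding smooth_curve_def
    by (meson differentiableI_vector time_deriv_funpow_has_derivative)
qed

lemma time_deriv_funpow_add_scaleR:
  assumes "smooth u" "smooth v"
  shows "(time_deriv ^^ k) (\<lambda>t. u t + c *\<^sub>R v t) t = (time_deriv ^^ k) u t + c *\<^sub>R (time_deriv ^^ k) v t"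
proof -
  let ?U = "\<lambda>k t. (time_deriv ^^ k) u t + c *\<^sub>R (time_deriv ^^ k) v t"
  have "(?U k has_vector_derivative ?U (Suc k) t) (at t)" for k t
    using assms
    by (intro has_vector_derivative_add time_deriv_funpow_has_derivative
        bounded_linear.has_vector_derivative[OF bounded_linear_scaleR_right])
  from fun_cong[OF derivative_family_unique[of ?U, OF this]] show ?thesis by simp
qed

text \<open>
  Differentiation is a local operation. This makes a cutoff invisible to the jets of a curve on
  the region where the cutoff equals 1.
\<close>

lemma time_deriv_funpow_local:
  assumes "open S" and "\<And>t. t \<in> S \<Longrightarrow> u t = v t"
  shows "t \<in> S \<Longrightarrow> (time_deriv ^^ k) u t = (time_deriv ^^ k) v t"
proof (induction k arbitrary: t)
  case (Suc k)
  have "\<forall>\<^sub>F x in nhds t. x \<in> UNIV \<longrightarrow> (time_deriv ^^ k) u x = (time_deriv ^^ k) v x"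
    using eventually_nhds_in_open[OF assms(1) Suc.prems] by eventually_elim (use Suc.IH in auto)
  then have "vector_derivative ((time_deriv ^^ k) u) (at t) = vector_derivative ((time_deriv ^^ k) v) (at t)"
    by (rule vector_derivative_cong_eq) auto
  then show ?case
    by (simp add: time_deriv_def[of "(time_deriv ^^ k) u"] time_deriv_def[of "(time_deriv ^^ k) v"])
qed (use assms in auto)

lemma time_deriv_funpow_zero: "(time_deriv ^^ k) (\<lambda>t. 0) t = 0"
  using fun_cong[OF derivative_family_unique[of "\<lambda>k t. 0", OF has_vector_derivative_const]] by simp

text \<open>
  Enlarging the support by 1 on both sides puts the end points in the open set where the curve
  vanishes identically, so that all its derivatives vanish there as well; this is what kills the
  boundary terms of integrations by parts.
\<close>

lemma test_curve_support:
  assumes "test_curve \<phi>"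
  obtains a b where "a < b" and "\<And>t k. t \<notin> {a<..<b} \<Longrightarrow> (time_deriv ^^ k) \<phi> t = 0"
proof -
  from assms obtain a b where ab: "\<And>t. t \<notin> {a..b} \<Longrightarrow> \<phi> t = 0"
    by (auto simp: test_curve_def)
  have "(time_deriv ^^ k) \<phi> t = 0" if "t \<notin> {min a b - 1<..<max a b + 1}" for t k
  proof -
    have "(time_deriv ^^ k) \<phi> t = (time_deriv ^^ k) (\<lambda>t. 0) t"
      by (rule time_deriv_funpow_local[of "- {a..b}"]) (use ab that in auto)
    then show ?thesis by (simp add: time_deriv_funpow_zero)
  qed
  then show ?thesis by (intro that[of "min a b - 1" "max a b + 1"]) auto
qed

text \<open>
  Every finite jet is the jet of its Taylor polynomial. Statements that hold along all smooth
  curves are turned into identities of differential functions in this way.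
\<close>

lemma jet_attained:
  obtains u where "smooth u" and "\<And>k. k \<le> N \<Longrightarrow> (time_deriv ^^ k) u s = z k"
proof -
  define y where "y k = (if k \<le> N then z k else 0)" for k
  define U where "U m t = (\<Sum>i\<le>N. ((t - s) ^ i / fact i) *\<^sub>R y (i + m))" for m t
  have U: "(U m has_vector_derivative U (Suc m) t) (at t)" for m t
  proof -
    have "((\<lambda>t. ((t - s) ^ i / fact i) *\<^sub>R y (i + m)) has_vector_derivative
        (if i = 0 then 0 else ((t - s) ^ (i - 1) / fact (i - 1)) *\<^sub>R y (i + m))) (at t)" for i
    proof -
      have "((\<lambda>t. (t - s) ^ i / fact i) has_real_derivative
          (if i = 0 then 0 else (t - s) ^ (i - 1) / fact (i - 1))) (at t)"
      proof (cases i)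
        case (Suc n)
        have d: "((\<lambda>t. (t - s) ^ Suc n) has_real_derivative (1 + of_nat n) * (1 * (t - s) ^ n)) (at t)"
          by (rule DERIV_power_Suc) (auto intro!: derivative_eq_intros)
        have e: "(1 + real n) * (1 * (t - s) ^ n) / fact (Suc n) = (t - s) ^ n / fact n"
          unfolding fact_Suc of_nat_Suc mult_1 by (rule nonzero_mult_divide_mult_cancel_left) linarith
        show ?thesis
          using DERIV_cdivide[OF d, of "fact (Suc n)", unfolded e] unfolding Suc by simp
      qed auto
      from has_vector_derivative_scaleR[OF this has_vector_derivative_const] show ?thesis
        by (auto split: if_splits)
    qed
    then have "(U m has_vector_derivative
        (\<Sum>i\<le>N. if i = 0 then 0 else ((t - s) ^ (i - 1) / fact (i - 1)) *\<^sub>R y (i + m))) (at t)"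
      unfolding U_def by (intro has_vector_derivative_sum)
    \<comment> \<open>The extra summand vanishes because \<open>y\<close> is 0 beyond \<open>N\<close>; it is there for the index shift.\<close>
    also have "(\<Sum>i\<le>N. if i = 0 then 0 else ((t - s) ^ (i - 1) / fact (i - 1)) *\<^sub>R y (i + m))
        = (\<Sum>i\<le>Suc N. if i = 0 then 0 else ((t - s) ^ (i - 1) / fact (i - 1)) *\<^sub>R y (i + m))"
      by (simp add: y_def)
    also have "\<dots> = U (Suc m) t"
      unfolding U_def by (subst sum.atMost_Suc_shift) simp
    finally show ?thesis .
  qed
  have "(time_deriv ^^ k) (U 0) s = z k" if "k \<le> N" for k
  proof -
    have "U k s = (\<Sum>i\<le>N. if i = 0 then y k else 0)"
      unfolding U_def by (intro sum.cong) (auto simp: power_0_left)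
    then show ?thesis
      using that by (simp add: derivative_family_unique[of U, OF U] y_def)
  qed
  then show ?thesis
    using derivative_family_smooth[of U, OF U] that by blast
qed


section \<open>Bump functions and the fundamental lemma\<close>

text \<open>
  The functions \<open>p(1/x) exp(-1/x)\<close> for \<open>x > 0\<close>, extended by 0. The family is closed under
  differentiation, with \<open>p\<close> replaced by \<open>X\<^sup>2 (p - p')\<close>, and this gives the smoothness of
  \<open>exp(-1/x)\<close> across 0.
\<close>

definition flat_exp :: "real poly \<Rightarrow> real \<Rightarrow> real" where
  "flat_exp p x = (if x > 0 then poly p (1 / x) * exp (- 1 / x) else 0)"

lemma flat_exp_tendsto_0: "(flat_exp p \<longlongrightarrow> 0) (at_right 0)"
proof -
  have "((\<lambda>y. \<Sum>i\<le>degree p. coeff p i * (y ^ i / exp y)) \<longlongrightarrow> 0) at_top"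
    by (intro tendsto_null_sum tendsto_mult_right_zero tendsto_power_div_exp_0)
  then have "((\<lambda>x. \<Sum>i\<le>degree p. coeff p i * (inverse x ^ i / exp (inverse x))) \<longlongrightarrow> 0) (at_right 0)"
    by (rule filterlim_compose[OF _ filterlim_inverse_at_top_right])
  then show ?thesis
  proof (rule Lim_transform_eventually)
    show "\<forall>\<^sub>F x in at_right 0. (\<Sum>i\<le>degree p. coeff p i * (inverse x ^ i / exp (inverse x))) = flat_exp p x"
      using eventually_at_right_less[of 0]
      by eventually_elim
        (simp add: flat_exp_def poly_altdef sum_divide_distrib exp_minus inverse_eq_divide)
  qed
qed

lemma flat_exp_deriv:
  "(flat_exp p has_real_derivative flat_exp ([:0, 0, 1:] * (p - pderiv p)) x) (at x)"
proof (cases "x = 0")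
  case False
  have "\<exists>S. open S \<and> x \<in> S \<and> (if x > 0 then S \<subseteq> {0<..} else S \<subseteq> {..<0})"
    using False by (intro exI[of _ "if x > 0 then {0<..} else {..<0}"]) auto
  then obtain S where S: "open S" "x \<in> S" "if x > 0 then S \<subseteq> {0<..} else S \<subseteq> {..<0}"
    by blast
  show ?thesis
  proof (cases "x > 0")
    case True
    have "((\<lambda>x. poly p (1 / x) * exp (- 1 / x)) has_real_derivative
        flat_exp ([:0, 0, 1:] * (p - pderiv p)) x) (at x)"
      using True
      by (auto intro!: derivative_eq_intros poly_DERIV[THEN DERIV_chain2]
          simp: flat_exp_def field_simps power2_eq_square)
    then show ?thesis
      by (rule has_field_derivative_transform_within_open[OF _ S(1,2)])
        (use S True in \<open>auto simp: flat_exp_def\<close>)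
  next
    case F: False
    have "((\<lambda>x. 0) has_real_derivative flat_exp ([:0, 0, 1:] * (p - pderiv p)) x) (at x)"
      using F by (simp add: flat_exp_def)
    then show ?thesis
      by (rule has_field_derivative_transform_within_open[OF _ S(1,2)])
        (use S F in \<open>auto simp: flat_exp_def\<close>)
  qed
next
  case True
  have "((\<lambda>h. (flat_exp p (0 + h) - flat_exp p 0) / h) \<longlongrightarrow> 0) (at 0)"
  proof (rule filterlim_split_at)
    have "\<forall>\<^sub>F h in at_right 0. flat_exp ([:0, 1:] * p) h = (flat_exp p (0 + h) - flat_exp p 0) / h"
      using eventually_at_right_less[of 0] by eventually_elim (simp add: flat_exp_def)
    then show "((\<lambda>h. (flat_exp p (0 + h) - flat_exp p 0) / h) \<longlongrightarrow> 0) (at_right 0)"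
      by (rule Lim_transform_eventually[OF flat_exp_tendsto_0])
    have "\<forall>\<^sub>F h in at_left 0. 0 = (flat_exp p (0 + h) - flat_exp p 0) / h"
      using eventually_at_left_real[of "-1" "0::real", simplified] by eventually_elim (auto simp: flat_exp_def)
    then show "((\<lambda>h. (flat_exp p (0 + h) - flat_exp p 0) / h) \<longlongrightarrow> 0) (at_left 0)"
      by (rule Lim_transform_eventually[OF tendsto_const])
  qed
  then show ?thesis
    using True by (simp add: DERIV_def flat_exp_def)
qed

lemma smooth_flat_exp: "smooth (flat_exp p)"
proof -
  have "ndiff n (flat_exp p)" for n p
    by (induction n arbitrary: p)
      (use flat_exp_deriv in \<open>auto simp: has_real_derivative_iff_has_vector_derivative\<close>)
  then show ?thesis by (simp add: smooth_def)
qed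

lemma flat_exp_1_pos_iff: "flat_exp 1 x > 0 \<longleftrightarrow> x > 0"
  and flat_exp_1_nonneg: "flat_exp 1 x \<ge> 0"
  by (auto simp: flat_exp_def)

lemma smooth_bump:
  fixes a b :: real
  obtains \<eta> :: "real \<Rightarrow> real"
  where "smooth \<eta>" "\<And>t. \<eta> t \<ge> 0" "\<And>t. \<eta> t > 0 \<longleftrightarrow> t \<in> {a<..<b}"
proof
  let ?\<eta> = "\<lambda>t. flat_exp 1 (1 * t + (- a)) * flat_exp 1 (- 1 * t + b)"
  show "smooth ?\<eta>"
    by (intro smooth_bilinear[OF bounded_bilinear_mult] smooth_affine smooth_flat_exp)
  show "?\<eta> t \<ge> 0" for t
    by (simp add: flat_exp_1_nonneg)
  show "?\<eta> t > 0 \<longleftrightarrow> t \<in> {a<..<b}" for t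
    using flat_exp_1_pos_iff[of "t - a"] flat_exp_1_pos_iff[of "b - t"]
      flat_exp_1_nonneg[of "t - a"] flat_exp_1_nonneg[of "b - t"]
    by (auto simp: zero_less_mult_iff)
qed

text \<open>
  The quotient \<open>\<theta>(x) = e(x) / (e(x) + e(1 - x))\<close> with \<open>e(x) = exp(-1/x)\<close> for \<open>x > 0\<close> and
  \<open>e(x) = 0\<close> otherwise is a smooth step from 0 to 1; the product of a step up and a step down is
  a plateau.
\<close>

lemma smooth_plateau:
  fixes a b :: real
  obtains \<rho> :: "real \<Rightarrow> real"
  where "smooth \<rho>" "\<And>t. t \<in> {a..b} \<Longrightarrow> \<rho> t = 1" "\<And>t. t \<notin> {a - 1..b + 1} \<Longrightarrow> \<rho> t = 0"
proof
  define \<theta> where "\<theta> x = flat_exp 1 x * inverse (flat_exp 1 x + flat_exp 1 (- 1 * x + 1))" for x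
  have pos: "flat_exp 1 x + flat_exp 1 (- 1 * x + 1) > 0" for x
    using flat_exp_1_pos_iff[of x] flat_exp_1_pos_iff[of "1 - x"]
      flat_exp_1_nonneg[of x] flat_exp_1_nonneg[of "1 - x"]
    by (cases "x > 0") (auto simp: add_pos_nonneg add_nonneg_pos)
  have \<theta>: "smooth \<theta>"
    unfolding \<theta>_def
    by (intro smooth_bilinear[OF bounded_bilinear_mult] smooth_inverse smooth_add smooth_affine
        smooth_flat_exp) (use pos in \<open>auto simp: less_le\<close>)
  have \<theta>1: "\<theta> x = 1" if "x \<ge> 1" for x
    using that pos[of x] by (simp add: \<theta>_def flat_exp_def)
  have \<theta>0: "\<theta> x = 0" if "x \<le> 0" for x
    using that by (simp add: \<theta>_def flat_exp_def)
  let ?\<rho> = "\<lambda>t. \<theta> (1 * t + (1 - a)) * \<theta> (- 1 * t + (b + 1))"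
  show "smooth ?\<rho>"
    by (intro smooth_bilinear[OF bounded_bilinear_mult] smooth_affine \<theta>)
  show "?\<rho> t = 1" if "t \<in> {a..b}" for t
    using that by (simp add: \<theta>1)
  show "?\<rho> t = 0" if "t \<notin> {a - 1..b + 1}" for t
    using that \<theta>0[of "t + (1 - a)"] \<theta>0[of "- t + (b + 1)"] by auto
qed

lemma integral_UNIV_eq_interval:
  fixes f :: "real \<Rightarrow> 'a::euclidean_space"
  assumes "\<And>t. t \<notin> {a<..<b} \<Longrightarrow> f t = 0"
  shows "integral UNIV f = integral {a..b} f"
proof -
  have "f = (\<lambda>t. if t \<in> {a..b} then f t else 0)"
    using assms by force
  then show ?thesis
    by (metis Henstock_Kurzweil_Integration.integral_restrict_UNIV)
qed

text \<open>
  If \<open>g\<close> does not vanish at \<open>t\<close>, then the real part of \<open>cnj (g t) * g\<close> is positive near \<open>t\<close>.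
  Testing against a bump concentrated there gives a nonzero integral.
\<close>

lemma fundamental_lemma:
  fixes g :: "real \<Rightarrow> complex"
  assumes cont: "continuous_on UNIV g"
    and zero: "\<And>\<eta> a b. smooth \<eta> \<Longrightarrow> (\<And>t. t \<notin> {a<..<b} \<Longrightarrow> \<eta> t = 0) \<Longrightarrow>
      integral UNIV (\<lambda>t. complex_of_real (\<eta> t) * g t) = 0"
  shows "g t = 0"
proof (rule ccontr)
  assume nz: "g t \<noteq> 0"
  define r where "r s = Re (cnj (g t) * g s)" for s
  have r_cont: "continuous_on S r" for S
    unfolding r_def by (intro continuous_intros continuous_on_subset[OF cont]) auto
  have "r t > 0"
    using nz by (simp add: r_def complex_eq_iff sum_power2_gt_zero_iff flip: power2_eq_square)
  have "open {s. r s > 0}"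
    using open_Collect_less[OF continuous_on_const r_cont] .
  with \<open>r t > 0\<close> obtain d where d: "d > 0" "\<And>s. \<bar>s - t\<bar> < d \<Longrightarrow> r s > 0"
    by (auto simp: open_dist dist_real_def)
  let ?a = "t - d" and ?b = "t + d"
  obtain \<eta> :: "real \<Rightarrow> real" where \<eta>: "smooth \<eta>" "\<And>s. \<eta> s \<ge> 0" "\<And>s. \<eta> s > 0 \<longleftrightarrow> s \<in> {?a<..<?b}"
    using smooth_bump[where a="?a" and b="?b"] by blast
  have \<eta>0: "\<eta> s = 0" if "s \<notin> {?a<..<?b}" for s
    using \<eta>(2,3) that by (metis less_eq_real_def)
  let ?h = "\<lambda>s. complex_of_real (\<eta> s) * g s"
  have h: "integral {?a..?b} ?h = 0"
    using zero[OF \<eta>(1) \<eta>0] integral_UNIV_eq_interval[of ?a ?b ?h] \<eta>0 by simp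
  have "?h integrable_on {?a..?b}"
    by (intro integrable_continuous_real continuous_intros smooth_continuous_on \<eta>
        continuous_on_subset[OF cont]) auto
  then have "(?h has_integral 0) {?a..?b}"
    using h by (simp add: has_integral_integrable_integral)
  then have "((\<lambda>s. Re (cnj (g t) * ?h s)) has_integral Re (cnj (g t) * 0)) {?a..?b}"
    by (intro has_integral_linear[of ?h _ _ "\<lambda>x. Re (cnj (g t) * x)", unfolded o_def]
        bounded_linear_compose[OF bounded_linear_Re bounded_linear_mult_right])
  then have "((\<lambda>s. \<eta> s * r s) has_integral 0) (cbox ?a ?b)"
    by (simp add: r_def algebra_simps)
  then have "\<eta> t * r t = 0"
  proof (rule has_integral_0_cbox_imp_0[rotated 2])
    show "continuous_on (cbox ?a ?b) (\<lambda>s. \<eta> s * r s)"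
      by (intro continuous_intros r_cont smooth_continuous_on \<eta>)
    show "\<eta> s * r s \<ge> 0" if "s \<in> box ?a ?b" for s
    proof (cases "s \<in> {?a<..<?b}")
      case True
      then show ?thesis
        using d(2)[of s] \<eta>(2)[of s] by (auto simp: abs_less_iff)
    qed (simp add: \<eta>0)
  qed (use \<open>d > 0\<close> in \<open>auto simp: box_real\<close>)
  then show False
    using \<open>r t > 0\<close> \<eta>(3)[of t] \<open>d > 0\<close> by simp
qed


section \<open>Differential functions and their directional derivatives\<close>

text \<open>
  A direction consists of a time component and a sequence of vectors, one for each order of
  differentiation; the jet space carries no vector space structure as a type, hence the explicit
  parametrization of its lines.
\<close>

definition jet_line :: "jet \<Rightarrow> real \<Rightarrow> (nat \<Rightarrow> complex ^ 4) \<Rightarrow> real \<Rightarrow> jet" where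
  "jet_line x \<tau> w h = (fst x + h * \<tau>, \<lambda>k. snd x k + h *\<^sub>R w k)"

definition dir_deriv :: "(jet \<Rightarrow> complex) \<Rightarrow> real \<Rightarrow> (nat \<Rightarrow> complex ^ 4) \<Rightarrow> jet \<Rightarrow> complex" where
  "dir_deriv f \<tau> w x = vector_derivative (\<lambda>h. f (jet_line x \<tau> w h)) (at 0)"

lemma jet_line_0 [simp]: "jet_line x \<tau> w 0 = x"
  by (simp add: jet_line_def)

lemma jet_line_line [simp]: "jet_line (jet_line x \<tau> w r) \<tau> w h = jet_line x \<tau> w (r + h)"
  by (simp add: jet_line_def algebra_simps)

lemma C_k_Suc_iff:
  "C_k (Suc n) f \<longleftrightarrow> continuous_on UNIV f \<and>
     (\<forall>\<tau> w. \<exists>g. C_k n g \<and> (\<forall>x. ((\<lambda>h. f (jet_line x \<tau> w h)) has_vector_derivative g x) (at 0)))"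
  by (simp add: jet_line_def)

lemma C_k_SucI:
  assumes "continuous_on UNIV f" "\<And>\<tau> w. C_k n (g \<tau> w)"
    "\<And>\<tau> w x. ((\<lambda>h. f (jet_line x \<tau> w h)) has_vector_derivative g \<tau> w x) (at 0)"
  shows "C_k (Suc n) f"
  unfolding C_k_Suc_iff using assms by blast

lemma C_k_SucE:
  assumes "C_k (Suc n) f"
  shows "C_k n (dir_deriv f \<tau> w)"
    and "((\<lambda>h. f (jet_line x \<tau> w h)) has_vector_derivative dir_deriv f \<tau> w x) (at 0)"
proof -
  from assms obtain g where g: "C_k n g"
    "\<And>x. ((\<lambda>h. f (jet_line x \<tau> w h)) has_vector_derivative g x) (at 0)"
    unfolding C_k_Suc_iff by blast
  have "g = dir_deriv f \<tau> w"
    using g(2)[THEN vector_derivative_at] by (auto simp: dir_deriv_def)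
  with g show "C_k n (dir_deriv f \<tau> w)"
    "((\<lambda>h. f (jet_line x \<tau> w h)) has_vector_derivative dir_deriv f \<tau> w x) (at 0)"
    by auto
qed

lemma C_k_continuous: "C_k n f \<Longrightarrow> continuous_on UNIV f"
  by (cases n) auto

lemma C_k_SucD: "C_k (Suc n) f \<Longrightarrow> C_k n f"
proof (induction n arbitrary: f)
  case (Suc n)
  show ?case
    using C_k_SucE[OF Suc.prems] C_k_continuous[OF Suc.prems] Suc.IH
    by (intro C_k_SucI[where g="dir_deriv f"]) auto
qed simp

lemma C_k_const: "C_k n (\<lambda>x. c)"
  by (induction n arbitrary: c) (auto intro!: exI[of _ "\<lambda>x. 0"])

lemma C_k_add: "C_k n f \<Longrightarrow> C_k n g \<Longrightarrow> C_k n (\<lambda>x. f x + g x)"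
proof (induction n arbitrary: f g)
  case (Suc n)
  note f = C_k_SucE[OF Suc.prems(1)] C_k_continuous[OF Suc.prems(1)]
  note g = C_k_SucE[OF Suc.prems(2)] C_k_continuous[OF Suc.prems(2)]
  show ?case
    by (rule C_k_SucI[where g="\<lambda>\<tau> w x. dir_deriv f \<tau> w x + dir_deriv g \<tau> w x"])
      (intro continuous_on_add has_vector_derivative_add Suc.IH f g)+
qed (auto intro: continuous_on_add)

lemma C_k_mult: "C_k n f \<Longrightarrow> C_k n g \<Longrightarrow> C_k n (\<lambda>x. f x * g x)"
proof (induction n arbitrary: f g)
  case (Suc n)
  note f = C_k_SucE[OF Suc.prems(1)] C_k_continuous[OF Suc.prems(1)] C_k_SucD[OF Suc.prems(1)]
  note g = C_k_SucE[OF Suc.prems(2)] C_k_continuous[OF Suc.prems(2)] C_k_SucD[OF Suc.prems(2)]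
  show ?case
  proof (rule C_k_SucI[where g="\<lambda>\<tau> w x. f x * dir_deriv g \<tau> w x + dir_deriv f \<tau> w x * g x"])
    show "((\<lambda>h. f (jet_line x \<tau> w h) * g (jet_line x \<tau> w h)) has_vector_derivative
        f x * dir_deriv g \<tau> w x + dir_deriv f \<tau> w x * g x) (at 0)" for \<tau> w x
      using has_vector_derivative_mult[OF f(2) g(2), of x \<tau> w x \<tau> w] by simp
  qed (intro continuous_on_mult C_k_add Suc.IH f g)+
qed (auto intro: continuous_on_mult)

lemma C_k_linear:
  assumes T: "bounded_linear T"
  shows "C_k n f \<Longrightarrow> C_k n (\<lambda>x. T (f x))"
proof (induction n arbitrary: f)
  case 0
  then show ?case by (auto intro: bounded_linear.continuous_on[OF T])
next
  case (Suc n)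
  note f = C_k_SucE[OF Suc.prems(1)] C_k_continuous[OF Suc.prems(1)]
  show ?case
    by (rule C_k_SucI[where g="\<lambda>\<tau> w x. T (dir_deriv f \<tau> w x)"])
      (intro bounded_linear.continuous_on[OF T] bounded_linear.has_vector_derivative[OF T]
        Suc.IH f)+
qed

lemma C_k_time:
  assumes "smooth \<eta>"
  shows "C_k n (\<lambda>x. \<eta> (fst x))"
proof -
  have "ndiff (Suc n) \<eta>"
    using assms by (simp add: smooth_def del: ndiff.simps)
  then show ?thesis
  proof (induction n arbitrary: \<eta>)
    case 0
    then obtain \<eta>' where "\<And>t. (\<eta> has_vector_derivative \<eta>' t) (at t)"
      by auto
    then have "continuous_on UNIV \<eta>"
      by (blast intro: continuous_at_imp_continuous_on has_vector_derivative_continuous)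
    then have "continuous_on UNIV (\<lambda>x::jet. \<eta> (fst x))"
      by (rule continuous_on_compose2) (auto intro: continuous_intros)
    then show ?case by simp
  next
    case (Suc n)
    from Suc.prems obtain \<eta>' where \<eta>': "\<And>t. (\<eta> has_vector_derivative \<eta>' t) (at t)" "ndiff (Suc n) \<eta>'"
      unfolding ndiff.simps(2)[of "Suc n" \<eta>] by blast
    show ?case
    proof (rule C_k_SucI[where g="\<lambda>\<tau> w x. of_real \<tau> * \<eta>' (fst x)"])
      show "continuous_on UNIV (\<lambda>x::jet. \<eta> (fst x))"
        using C_k_continuous[OF Suc.IH[OF ndiff_SucD[OF Suc.prems]]] .
      show "C_k n (\<lambda>x. of_real \<tau> * \<eta>' (fst x))" for \<tau>
        by (intro C_k_mult C_k_const Suc.IH \<eta>')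
      fix \<tau> w and x :: jet
      have "((\<lambda>h. fst x + h * \<tau>) has_vector_derivative \<tau>) (at 0)"
        by (auto intro!: derivative_eq_intros simp flip: has_real_derivative_iff_has_vector_derivative)
      from vector_diff_chain_at[OF this \<eta>'(1)]
      show "((\<lambda>h. \<eta> (fst (jet_line x \<tau> w h))) has_vector_derivative of_real \<tau> * \<eta>' (fst x)) (at 0)"
        by (simp add: jet_line_def o_def scaleR_conv_of_real)
    qed
  qed
qed

lemma continuous_on_snd_coordinate: "continuous_on S (\<lambda>x::jet. snd x k)"
  by (rule continuous_on_subset[OF _ subset_UNIV],
      rule continuous_on_compose2[OF continuous_on_product_coordinates])
    (auto intro: continuous_intros)

lemma C_k_coordinate:
  assumes T: "bounded_linear T"
  shows "C_k n (\<lambda>x. T (snd x k))"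
proof (cases n)
  case 0
  then show ?thesis
    by (simp add: bounded_linear.continuous_on[OF T] continuous_on_snd_coordinate)
next
  case (Suc m)
  have "((\<lambda>h. T (snd (jet_line x \<tau> w h) k)) has_vector_derivative T (w k)) (at 0)" for x \<tau> w
    unfolding jet_line_def snd_conv
    by (rule bounded_linear.has_vector_derivative[OF T]) (auto intro!: derivative_eq_intros)
  then show ?thesis
    unfolding Suc
    by (intro C_k_SucI[where g="\<lambda>\<tau> w x. T (w k)"] C_k_const bounded_linear.continuous_on[OF T]
        continuous_on_snd_coordinate)
qed

definition depends_upto :: "nat \<Rightarrow> (jet \<Rightarrow> complex) \<Rightarrow> bool" where
  "depends_upto N f \<longleftrightarrow> (\<forall>t z z'. (\<forall>k\<le>N. z k = z' k) \<longrightarrow> f (t, z) = f (t, z'))"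

lemma depends_uptoD:
  "depends_upto N f \<Longrightarrow> fst x = fst y \<Longrightarrow> (\<And>k. k \<le> N \<Longrightarrow> snd x k = snd y k) \<Longrightarrow> f x = f y"
  by (cases x; cases y) (auto simp: depends_upto_def)

lemma depends_upto_mono: "depends_upto N f \<Longrightarrow> N \<le> M \<Longrightarrow> depends_upto M f"
  unfolding depends_upto_def by (meson le_trans)

lemma differential_function_iff:
  "differential_function f \<longleftrightarrow> (\<exists>N. depends_upto N f) \<and> (\<forall>n. C_k n f)"
  by (simp add: differential_function_def depends_upto_def)

lemma differential_has_dir_deriv:
  "differential_function f \<Longrightarrow> ((\<lambda>h. f (jet_line x \<tau> w h)) has_vector_derivative dir_deriv f \<tau> w x) (at 0)"
  using C_k_SucE(2)[of 0 f] unfolding differential_function_iff by blast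

lemma depends_upto_dir_deriv:
  assumes N: "depends_upto N f"
  shows "depends_upto N (dir_deriv f \<tau> w)"
  unfolding depends_upto_def
proof safe
  fix t and z z' :: "nat \<Rightarrow> complex ^ 4"
  assume "\<forall>k\<le>N. z k = z' k"
  then have "f (jet_line (t, z) \<tau> w h) = f (jet_line (t, z') \<tau> w h)" for h
    by (intro depends_uptoD[OF N]) (auto simp: jet_line_def)
  then show "dir_deriv f \<tau> w (t, z) = dir_deriv f \<tau> w (t, z')"
    by (simp add: dir_deriv_def)
qed

lemma differential_dir_deriv:
  assumes "differential_function f"
  shows "differential_function (dir_deriv f \<tau> w)"
proof -
  from assms obtain N where "depends_upto N (dir_deriv f \<tau> w)"
    by (auto simp: differential_function_iff intro: depends_upto_dir_deriv)
  moreover have "C_k n (dir_deriv f \<tau> w)" for n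
    using assms C_k_SucE(1)[of n f] unfolding differential_function_iff by blast
  ultimately show ?thesis
    unfolding differential_function_iff by blast
qed

lemma differential_continuous: "differential_function f \<Longrightarrow> continuous_on S f"
  unfolding differential_function_iff
  using C_k_continuous[of 0 f] continuous_on_subset[of UNIV f S] by blast

lemma common_order:
  assumes "differential_function f" "differential_function g"
  obtains N where "depends_upto N f" "depends_upto N g"
proof -
  from assms obtain M N where "depends_upto M f" "depends_upto N g"
    by (auto simp: differential_function_iff)
  then show ?thesis
    by (intro that[of "max M N"]) (auto intro: depends_upto_mono)
qed

lemma differential_const: "differential_function (\<lambda>x. c)"
  by (simp add: differential_function_iff depends_upto_def C_k_const)

lemma differential_add:
  assumes "differential_function f" "differential_function g"
  shows "differential_function (\<lambda>x. f x + g x)"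
proof -
  from common_order[OF assms] obtain N where "depends_upto N f" "depends_upto N g" .
  then have "depends_upto N (\<lambda>x. f x + g x)"
    unfolding depends_upto_def by metis
  then show ?thesis
    using assms unfolding differential_function_iff by (blast intro: C_k_add)
qed

lemma differential_mult:
  assumes "differential_function f" "differential_function g"
  shows "differential_function (\<lambda>x. f x * g x)"
proof -
  from common_order[OF assms] obtain N where "depends_upto N f" "depends_upto N g" .
  then have "depends_upto N (\<lambda>x. f x * g x)"
    unfolding depends_upto_def by metis
  then show ?thesis
    using assms unfolding differential_function_iff by (blast intro: C_k_mult)
qed

lemma differential_linear:
  assumes "bounded_linear T" "differential_function f"
  shows "differential_function (\<lambda>x. T (f x))"
proof -
  from assms(2) obtain N where "depends_upto N f"
    by (auto simp: differential_function_iff)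
  then have "depends_upto N (\<lambda>x. T (f x))"
    unfolding depends_upto_def by metis
  then show ?thesis
    using assms unfolding differential_function_iff by (blast intro: C_k_linear)
qed

lemma differential_minus: "differential_function f \<Longrightarrow> differential_function (\<lambda>x. - f x)"
  by (rule differential_linear[OF bounded_linear_minus[OF bounded_linear_ident]])

lemma differential_diff:
  "differential_function f \<Longrightarrow> differential_function g \<Longrightarrow> differential_function (\<lambda>x. f x - g x)"
  using differential_add[OF _ differential_minus] by simp

lemma differential_sum:
  "(\<And>i. i \<in> I \<Longrightarrow> differential_function (f i)) \<Longrightarrow> differential_function (\<lambda>x. \<Sum>i\<in>I. f i x)"
  by (induction I rule: infinite_finite_induct) (auto intro: differential_const differential_add)

lemma differential_time: "smooth \<eta> \<Longrightarrow> differential_function (\<lambda>x. \<eta> (fst x))"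
  unfolding differential_function_iff depends_upto_def by (simp add: C_k_time)

lemma differential_coordinate:
  assumes "bounded_linear T"
  shows "differential_function (\<lambda>x. T (snd x k))"
proof -
  have "depends_upto k (\<lambda>x. T (snd x k))"
    by (simp add: depends_upto_def)
  then show ?thesis
    unfolding differential_function_iff using C_k_coordinate[OF assms] by blast
qed

lemma dir_deriv_eqI: "((\<lambda>h. f (jet_line x \<tau> w h)) has_vector_derivative d) (at 0) \<Longrightarrow> dir_deriv f \<tau> w x = d"
  unfolding dir_deriv_def by (rule vector_derivative_at)

lemma dir_deriv_add:
  "differential_function f \<Longrightarrow> differential_function g \<Longrightarrow>
    dir_deriv (\<lambda>x. f x + g x) \<tau> w x = dir_deriv f \<tau> w x + dir_deriv g \<tau> w x"
  by (intro dir_deriv_eqI has_vector_derivative_add differential_has_dir_deriv)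

lemma dir_deriv_mult:
  assumes "differential_function f" "differential_function g"
  shows "dir_deriv (\<lambda>x. f x * g x) \<tau> w x = dir_deriv f \<tau> w x * g x + f x * dir_deriv g \<tau> w x"
  using has_vector_derivative_mult[OF assms[THEN differential_has_dir_deriv, of x \<tau> w]]
  by (intro dir_deriv_eqI) (simp add: add.commute)

lemma dir_deriv_linear:
  "bounded_linear T \<Longrightarrow> differential_function f \<Longrightarrow> dir_deriv (\<lambda>x. T (f x)) \<tau> w x = T (dir_deriv f \<tau> w x)"
  by (rule dir_deriv_eqI, rule bounded_linear.has_vector_derivative, assumption, rule differential_has_dir_deriv)

lemma dir_deriv_const: "dir_deriv (\<lambda>x. c) \<tau> w x = 0"
  by (intro dir_deriv_eqI has_vector_derivative_const)

lemma dir_deriv_sum: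
  "(\<And>i. i \<in> I \<Longrightarrow> differential_function (f i)) \<Longrightarrow>
    dir_deriv (\<lambda>x. \<Sum>i\<in>I. f i x) \<tau> w x = (\<Sum>i\<in>I. dir_deriv (f i) \<tau> w x)"
  by (intro dir_deriv_eqI has_vector_derivative_sum differential_has_dir_deriv)

lemma jet_line_derivative_at:
  assumes "\<And>x. ((\<lambda>h. f (jet_line x \<tau> w h)) has_vector_derivative g x) (at 0)"
  shows "((\<lambda>h. f (jet_line x \<tau> w h)) has_vector_derivative g (jet_line x \<tau> w r)) (at r)"
proof -
  have "((\<lambda>h. h - r) has_vector_derivative 1) (at r)"
    by (auto intro!: derivative_eq_intros)
  moreover have "((\<lambda>h. f (jet_line x \<tau> w (r + h))) has_vector_derivative g (jet_line x \<tau> w r)) (at (r - r))"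
    using assms[of "jet_line x \<tau> w r"] by simp
  ultimately show ?thesis
    using vector_diff_chain_at[of "\<lambda>h. h - r" 1 r "\<lambda>h. f (jet_line x \<tau> w (r + h))"]
    by (simp add: o_def)
qed


section \<open>The chain rule on the jet space\<close>

text \<open>
  Continuity of the directional derivatives on the whole jet space makes them additive in the
  direction. The directions are added one at a time: in the two variables \<open>s\<close> (moving in the old
  directions) and \<open>r\<close> (moving in the new one), one partial derivative exists by induction, and the
  other exists everywhere and is continuous, which suffices for differentiability.
\<close>

lemma chain_rule_finite:
  assumes "finite I"
    and cont: "\<And>i. i \<in> I \<Longrightarrow> continuous_on UNIV (g i)"
    and deriv: "\<And>i x. i \<in> I \<Longrightarrow>
      ((\<lambda>h. f (jet_line x (\<tau> i) (w i) h)) has_vector_derivative g i x) (at 0)"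
    and a: "\<And>i s. i \<in> I \<Longrightarrow> (a i has_vector_derivative a' i s) (at s)"
  shows "((\<lambda>s. f (fst x + (\<Sum>i\<in>I. a i s * \<tau> i), \<lambda>k. snd x k + (\<Sum>i\<in>I. a i s *\<^sub>R w i k)))
    has_vector_derivative (\<Sum>i\<in>I. a' i s *\<^sub>R
      g i (fst x + (\<Sum>i\<in>I. a i s * \<tau> i), \<lambda>k. snd x k + (\<Sum>i\<in>I. a i s *\<^sub>R w i k)))) (at s)"
  using assms
proof (induction I arbitrary: x rule: finite_induct)
  case (insert j I)
  define y where "y s = (fst x + (\<Sum>i\<in>I. a i s * \<tau> i), \<lambda>k. snd x k + (\<Sum>i\<in>I. a i s *\<^sub>R w i k))" for s
  let ?x' = "jet_line x (\<tau> j) (w j) (a j s)"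
  have y: "jet_line (y s') (\<tau> j) (w j) (a j s) = (fst ?x' + (\<Sum>i\<in>I. a i s' * \<tau> i),
      \<lambda>k. snd ?x' k + (\<Sum>i\<in>I. a i s' *\<^sub>R w i k))" for s'
    by (simp add: y_def jet_line_def algebra_simps)
  have yj: "jet_line (y s) (\<tau> j) (w j) (a j s) = (fst x + (\<Sum>i\<in>insert j I. a i s * \<tau> i),
      \<lambda>k. snd x k + (\<Sum>i\<in>insert j I. a i s *\<^sub>R w i k))" for s
    using insert.hyps by (simp add: y_def jet_line_def algebra_simps)
  let ?z = "jet_line (y s) (\<tau> j) (w j) (a j s)"
  let ?H = "\<lambda>s r. f (jet_line (y s) (\<tau> j) (w j) r)"
  let ?D = "\<lambda>s r. blinfun_scaleR_left (g j (jet_line (y s) (\<tau> j) (w j) r))"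
  have a_cont: "continuous_on UNIV (a i)" if "i \<in> insert j I" for i
    using insert.prems(3)[OF that]
    by (meson continuous_at_imp_continuous_on has_vector_derivative_continuous)
  have "continuous_on UNIV (\<lambda>(s, r). g j (jet_line (y s) (\<tau> j) (w j) r))"
    unfolding split_beta
    by (rule continuous_on_compose2[OF insert.prems(1)], simp)
      (auto simp: jet_line_def y_def intro!: continuous_intros continuous_on_compose2[OF a_cont])
  then have D_cont: "continuous_on UNIV (\<lambda>(s, r). ?D s r)"
    unfolding split_beta
    by (intro bounded_linear.continuous_on[OF bounded_linear_blinfun_scaleR_left])
  have "((\<lambda>s'. ?H s' (a j s)) has_vector_derivative (\<Sum>i\<in>I. a' i s *\<^sub>R g i ?z)) (at s)"
    using insert.IH[of ?x'] insert.prems unfolding y by simp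
  then have "((\<lambda>(s, r). ?H s r) has_derivative
      (\<lambda>(ts, tr). ts *\<^sub>R (\<Sum>i\<in>I. a' i s *\<^sub>R g i ?z) + ?D s (a j s) tr)) (at (s, a j s) within UNIV \<times> UNIV)"
  proof (intro has_derivative_partialsI)
    show "((\<lambda>s'. ?H s' (a j s)) has_derivative (\<lambda>ts. ts *\<^sub>R (\<Sum>i\<in>I. a' i s *\<^sub>R g i ?z))) (at s)"
      if "((\<lambda>s'. ?H s' (a j s)) has_vector_derivative (\<Sum>i\<in>I. a' i s *\<^sub>R g i ?z)) (at s)"
      using that by (simp add: has_vector_derivative_def)
    show "((\<lambda>r. ?H s r) has_derivative blinfun_apply (?D s r)) (at r)" for s r
      using jet_line_derivative_at[of f "\<tau> j" "w j" "g j", OF insert.prems(2)]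
      by (simp add: has_vector_derivative_def)
    show "continuous (at (s, a j s) within UNIV \<times> UNIV) (\<lambda>(s, r). ?D s r)"
      using D_cont by (simp add: continuous_on_eq_continuous_at)
  qed auto
  then have H: "((\<lambda>(s, r). ?H s r) has_derivative
      (\<lambda>(ts, tr). ts *\<^sub>R (\<Sum>i\<in>I. a' i s *\<^sub>R g i ?z) + ?D s (a j s) tr)) (at (s, a j s))"
    by simp
  have c: "((\<lambda>s. (s, a j s)) has_vector_derivative (1, a' j s)) (at s)"
    using insert.prems(3)[of j] by (auto intro!: derivative_eq_intros)
  have "((\<lambda>s. ?H s (a j s)) has_vector_derivative
      (\<Sum>i\<in>I. a' i s *\<^sub>R g i ?z) + a' j s *\<^sub>R g j ?z) (at s)"
    using vector_derivative_diff_chain_within[OF c has_derivative_at_withinI[OF H]]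
    by (simp add: o_def)
  then show ?case
    using insert.hyps unfolding yj by (simp add: add.commute)
qed simp

definition unit_dir :: "nat \<Rightarrow> complex ^ 4 \<Rightarrow> nat \<Rightarrow> complex ^ 4" where
  "unit_dir k b = (\<lambda>l. if l = k then b else 0)"

text \<open>
  A function of order \<open>N\<close> sees only time and the finitely many real coordinates \<open>Z k s \<bullet> b\<close> with
  \<open>k \<le> N\<close>, so the finite chain rule applies with these coordinates as directions.
\<close>

lemma chain_rule_expanded:
  assumes f: "differential_function f" and N: "depends_upto N f"
    and \<tau>: "\<And>s. (\<tau> has_vector_derivative \<tau>' s) (at s)"
    and Z: "\<And>k s. (Z k has_vector_derivative Z' k s) (at s)"
  shows "((\<lambda>s. f (\<tau> s, \<lambda>k. Z k s)) has_vector_derivative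
    \<tau>' s *\<^sub>R dir_deriv f 1 (\<lambda>k. 0) (\<tau> s, \<lambda>k. Z k s) +
    (\<Sum>k\<le>N. \<Sum>b\<in>Basis. (Z' k s \<bullet> b) *\<^sub>R dir_deriv f 0 (unit_dir k b) (\<tau> s, \<lambda>k. Z k s))) (at s)"
proof -
  let ?J = "{..N} \<times> (Basis :: (complex ^ 4) set)"
  let ?I = "insert None (Some ` ?J)"
  \<comment> \<open>\<open>None\<close> stands for the time coordinate.\<close>
  define a where "a i s = (case i of None \<Rightarrow> \<tau> s | Some (k, b) \<Rightarrow> Z k s \<bullet> b)" for i s
  define a' where "a' i s = (case i of None \<Rightarrow> \<tau>' s | Some (k, b) \<Rightarrow> Z' k s \<bullet> b)" for i s
  define \<sigma> :: "(nat \<times> (complex ^ 4)) option \<Rightarrow> real"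
    where "\<sigma> i = (case i of None \<Rightarrow> 1 | Some _ \<Rightarrow> 0)" for i
  define w where "w i = (case i of None \<Rightarrow> \<lambda>k. 0 | Some (k, b) \<Rightarrow> unit_dir k b)" for i
  have sum_I: "(\<Sum>i\<in>?I. h i) = h None + (\<Sum>k\<le>N. \<Sum>b\<in>Basis. h (Some (k, b)))"
    for h :: "(nat \<times> (complex ^ 4)) option \<Rightarrow> 'x::comm_monoid_add"
    by (subst sum.insert) (auto simp: sum.reindex sum.cartesian_product intro!: sum.cong)
  have 1: "(\<Sum>i\<in>?I. a i s * \<sigma> i) = \<tau> s" for s
    unfolding sum_I by (simp add: a_def \<sigma>_def)
  have 2: "(\<Sum>i\<in>?I. a i s *\<^sub>R w i k) = Z k s" if "k \<le> N" for k s
  proof -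
    have "(\<Sum>i\<in>?I. a i s *\<^sub>R w i k) = (\<Sum>l\<le>N. \<Sum>b\<in>Basis. (Z l s \<bullet> b) *\<^sub>R unit_dir l b k)"
      unfolding sum_I by (simp add: a_def w_def)
    also have "\<dots> = (\<Sum>l\<le>N. if l = k then (\<Sum>b\<in>Basis. (Z l s \<bullet> b) *\<^sub>R b) else 0)"
      by (intro sum.cong) (auto simp: unit_dir_def)
    also have "\<dots> = (\<Sum>b\<in>Basis. (Z k s \<bullet> b) *\<^sub>R b)"
      using that by (subst sum.delta) auto
    finally show ?thesis
      by (simp only: euclidean_representation)
  qed
  let ?x = "(0, \<lambda>k. 0) :: jet"
  let ?p = "\<lambda>s. (fst ?x + (\<Sum>i\<in>?I. a i s * \<sigma> i), \<lambda>k. snd ?x k + (\<Sum>i\<in>?I. a i s *\<^sub>R w i k))"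
  have p: "h (?p s) = h (\<tau> s, \<lambda>k. Z k s)" if "depends_upto N h" for h s
    by (rule depends_uptoD[OF that]) (simp_all only: fst_conv snd_conv 1 2 add_0)
  have "((\<lambda>s. f (?p s)) has_vector_derivative (\<Sum>i\<in>?I. a' i s *\<^sub>R dir_deriv f (\<sigma> i) (w i) (?p s))) (at s)"
  proof (rule chain_rule_finite)
    show "(a i has_vector_derivative a' i s) (at s)" for i s
      unfolding a_def a'_def
    proof (cases i)
      case (Some kb)
      then show "((\<lambda>s. case i of None \<Rightarrow> \<tau> s | Some (k, b) \<Rightarrow> Z k s \<bullet> b) has_vector_derivative
          (case i of None \<Rightarrow> \<tau>' s | Some (k, b) \<Rightarrow> Z' k s \<bullet> b)) (at s)"
        using bounded_linear.has_vector_derivative[OF bounded_linear_inner_left Z]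
        by (simp add: split_beta)
    qed (simp add: \<tau>)
    show "continuous_on UNIV (dir_deriv f (\<sigma> i) (w i))" for i
      by (rule differential_continuous[OF differential_dir_deriv[OF f]])
    show "((\<lambda>h. f (jet_line x (\<sigma> i) (w i) h)) has_vector_derivative dir_deriv f (\<sigma> i) (w i) x) (at 0)" for i x
      by (rule differential_has_dir_deriv[OF f])
  qed simp
  then show ?thesis
    unfolding p[OF N] p[OF depends_upto_dir_deriv[OF N]]
    unfolding sum_I by (simp add: a'_def \<sigma>_def w_def)
qed

text \<open>
  Linearity of the directional derivative in its direction, in coordinate form.
\<close>

lemma dir_deriv_expand:
  assumes f: "differential_function f" and N: "depends_upto N f"
  shows "dir_deriv f \<tau> w x = \<tau> *\<^sub>R dir_deriv f 1 (\<lambda>k. 0) x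
    + (\<Sum>k\<le>N. \<Sum>b\<in>Basis. (w k \<bullet> b) *\<^sub>R dir_deriv f 0 (unit_dir k b) x)"
proof (rule dir_deriv_eqI)
  have t: "((\<lambda>h. fst x + h * \<tau>) has_vector_derivative \<tau>) (at h)" for h
    by (auto intro!: derivative_eq_intros simp flip: has_real_derivative_iff_has_vector_derivative)
  have z: "((\<lambda>h. snd x k + h *\<^sub>R w k) has_vector_derivative w k) (at h)" for h k
    by (auto intro!: derivative_eq_intros)
  show "((\<lambda>h. f (jet_line x \<tau> w h)) has_vector_derivative \<tau> *\<^sub>R dir_deriv f 1 (\<lambda>k. 0) x
    + (\<Sum>k\<le>N. \<Sum>b\<in>Basis. (w k \<bullet> b) *\<^sub>R dir_deriv f 0 (unit_dir k b) x)) (at 0)"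
    using chain_rule_expanded[where Z="\<lambda>k h. snd x k + h *\<^sub>R w k" and Z'="\<lambda>k h. w k"
        and s=0, OF assms t z]
    by (simp add: jet_line_def)
qed

lemma chain_rule:
  assumes f: "differential_function f"
    and \<tau>: "\<And>s. (\<tau> has_vector_derivative \<tau>' s) (at s)"
    and Z: "\<And>k s. (Z k has_vector_derivative Z' k s) (at s)"
  shows "((\<lambda>s. f (\<tau> s, \<lambda>k. Z k s)) has_vector_derivative
    dir_deriv f (\<tau>' s) (\<lambda>k. Z' k s) (\<tau> s, \<lambda>k. Z k s)) (at s)"
proof -
  from f obtain N where N: "depends_upto N f"
    by (auto simp: differential_function_iff)
  show ?thesis
    unfolding dir_deriv_expand[OF f N, of "\<tau>' s" "\<lambda>k. Z' k s"] by (rule chain_rule_expanded[OF f N \<tau> Z])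
qed

text \<open>
  The direction may itself vary with the jet: in the coordinate expansion it enters only through
  its coefficients.
\<close>

lemma differential_dir_deriv_along:
  assumes f: "differential_function f"
    and W: "\<And>k b. differential_function (\<lambda>x. complex_of_real (W x k \<bullet> b))"
  shows "differential_function (\<lambda>x. dir_deriv f c (W x) x)"
proof -
  from f obtain N where N: "depends_upto N f"
    by (auto simp: differential_function_iff)
  have "differential_function (\<lambda>x. of_real c * dir_deriv f 1 (\<lambda>k. 0) x
    + (\<Sum>k\<le>N. \<Sum>b\<in>Basis. complex_of_real (W x k \<bullet> b) * dir_deriv f 0 (unit_dir k b) x))"
    by (intro differential_add differential_sum differential_mult differential_const W
        differential_dir_deriv f)
  then show ?thesis
    by (simp add: dir_deriv_expand[OF f N, of c] scaleR_conv_of_real)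
qed


section \<open>The total time derivative\<close>

text \<open>
  The total time derivative: the directional derivative along the vector field that moves time
  with speed 1 and each \<open>z k\<close> with velocity \<open>z (k + 1)\<close>.
\<close>

definition Dt :: "(jet \<Rightarrow> complex) \<Rightarrow> jet \<Rightarrow> complex" where
  "Dt f x = dir_deriv f 1 (\<lambda>k. snd x (Suc k)) x"

lemma bounded_linear_of_real_inner: "bounded_linear (\<lambda>v. complex_of_real (v \<bullet> b))"
  by (intro bounded_linear_compose[OF bounded_linear_of_real] bounded_linear_inner_left)

lemma differential_Dt: "differential_function f \<Longrightarrow> differential_function (Dt f)"
  unfolding Dt_def[abs_def]
  by (intro differential_dir_deriv_along differential_coordinate bounded_linear_of_real_inner)

lemma differential_Dt_funpow: "differential_function f \<Longrightarrow> differential_function ((Dt ^^ k) f)"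
  by (induction k) (auto intro: differential_Dt)

lemma Dt_along_curve:
  assumes "differential_function f" "smooth u"
  shows "((\<lambda>t. f (prolong u t)) has_vector_derivative Dt f (prolong u t)) (at t)"
proof -
  have "((\<lambda>t. t) has_vector_derivative 1) (at t)" for t :: real
    by (auto intro!: derivative_eq_intros)
  from chain_rule[OF assms(1) this time_deriv_funpow_has_derivative[OF assms(2)]]
  show ?thesis
    by (simp add: prolong_def Dt_def)
qed

lemma smooth_along_curve:
  assumes "differential_function f" "smooth u"
  shows "smooth (\<lambda>t. f (prolong u t))"
proof -
  have "ndiff n (\<lambda>t. f (prolong u t))" if "differential_function f" for n f
    using that
  proof (induction n arbitrary: f)
    case (Suc n)
    show ?case
      by (rule ndiff_SucI[OF Dt_along_curve[OF Suc.prems assms(2)] Suc.IH[OF differential_Dt[OF Suc.prems]]])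
  qed simp
  with assms(1) show ?thesis by (auto simp: smooth_def)
qed

lemma Dt_mult:
  "differential_function f \<Longrightarrow> differential_function g \<Longrightarrow>
    Dt (\<lambda>x. f x * g x) x = Dt f x * g x + f x * Dt g x"
  unfolding Dt_def by (rule dir_deriv_mult)

lemma Dt_add:
  "differential_function f \<Longrightarrow> differential_function g \<Longrightarrow> Dt (\<lambda>x. f x + g x) x = Dt f x + Dt g x"
  unfolding Dt_def by (rule dir_deriv_add)

lemma Dt_linear:
  "bounded_linear T \<Longrightarrow> differential_function f \<Longrightarrow> Dt (\<lambda>x. T (f x)) x = T (Dt f x)"
  unfolding Dt_def by (rule dir_deriv_linear)

lemma Dt_const: "Dt (\<lambda>x. c) x = 0"
  unfolding Dt_def by (rule dir_deriv_const)

lemma Dt_funpow_add: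
  assumes "differential_function f" "differential_function g"
  shows "(Dt ^^ k) (\<lambda>x. f x + g x) x = (Dt ^^ k) f x + (Dt ^^ k) g x"
proof (induction k arbitrary: x)
  case (Suc k)
  then have "(Dt ^^ k) (\<lambda>x. f x + g x) = (\<lambda>x. (Dt ^^ k) f x + (Dt ^^ k) g x)"
    by auto
  then show ?case
    by (simp add: Dt_add differential_Dt_funpow assms)
qed simp

lemma Dt_funpow_zero: "(Dt ^^ k) (\<lambda>x. 0) x = 0"
proof (induction k arbitrary: x)
  case (Suc k)
  then have "(Dt ^^ k) (\<lambda>x. 0) = (\<lambda>x. 0)"
    by auto
  then show ?case
    by (simp add: Dt_const)
qed simp

lemma Dt_funpow_sum:
  assumes "finite I" "\<And>i. i \<in> I \<Longrightarrow> differential_function (f i)"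
  shows "(Dt ^^ k) (\<lambda>x. \<Sum>i\<in>I. f i x) x = (\<Sum>i\<in>I. (Dt ^^ k) (f i) x)"
  using assms
  by (induction I rule: finite_induct) (auto simp: Dt_funpow_zero Dt_funpow_add differential_sum)

lemma Dt_funpow_linear:
  assumes "bounded_linear T" "differential_function f"
  shows "(Dt ^^ k) (\<lambda>x. T (f x)) x = T ((Dt ^^ k) f x)"
proof (induction k arbitrary: x)
  case (Suc k)
  then have "(Dt ^^ k) (\<lambda>x. T (f x)) = (\<lambda>x. T ((Dt ^^ k) f x))"
    by auto
  then show ?case
    by (simp add: Dt_linear differential_Dt_funpow assms)
qed simp

definition differential_vector :: "(jet \<Rightarrow> complex ^ 4) \<Rightarrow> bool" where
  "differential_vector A \<longleftrightarrow> (\<forall>i. differential_function (\<lambda>x. A x $ i))"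

text \<open>
  The direction in which the jet of a curve moves when the curve moves with velocity \<open>A\<close>, i.e. the
  prolongation of the evolutionary vector field of \<open>A\<close>.
\<close>

definition prolong_vector :: "(jet \<Rightarrow> complex ^ 4) \<Rightarrow> jet \<Rightarrow> nat \<Rightarrow> complex ^ 4" where
  "prolong_vector A x k = (\<chi> i. (Dt ^^ k) (\<lambda>y. A y $ i) x)"

lemma prolong_vector_0 [simp]: "prolong_vector A x 0 = A x"
  by (simp add: prolong_vector_def vec_eq_iff)

lemma has_vector_derivative_vec:
  fixes f :: "'n::finite \<Rightarrow> real \<Rightarrow> 'a::euclidean_space"
  assumes "\<And>i. (f i has_vector_derivative f' i) (at t)"
  shows "((\<lambda>t. \<chi> i. f i t) has_vector_derivative (\<chi> i. f' i)) (at t)"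
proof -
  have linearization: "bounded_linear (\<lambda>c::'a. axis i c :: 'a ^ 'n)" for i
    by (rule linear_conv_bounded_linear[THEN iffD1], rule linearI) (auto simp: axis_def vec_eq_iff)
  have "((\<lambda>t. \<Sum>i\<in>UNIV. axis i (f i t)) has_vector_derivative (\<Sum>i\<in>UNIV. axis i (f' i))) (at t)"
    by (intro has_vector_derivative_sum bounded_linear.has_vector_derivative[OF linearization] assms)
  moreover have "(\<Sum>i\<in>UNIV. axis i (c i)) = (\<chi> i. c i)" for c :: "'n \<Rightarrow> 'a"
    by (simp add: vec_eq_iff axis_def if_distrib cong: if_cong)
  ultimately show ?thesis by simp
qed

text \<open>
  Along a curve, prolonging the characteristic \<open>A\<close> formally is the same as differentiating
  the curve that \<open>A\<close> traces out.
\<close>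

lemma prolong_vector_along_curve:
  assumes A: "differential_vector A" and u: "smooth u"
  shows "smooth (\<lambda>t. A (prolong u t))"
    and "(time_deriv ^^ k) (\<lambda>t. A (prolong u t)) t = prolong_vector A (prolong u t) k"
proof -
  let ?U = "\<lambda>k t. prolong_vector A (prolong u t) k"
  have U: "(?U k has_vector_derivative ?U (Suc k) t) (at t)" for k t
    unfolding prolong_vector_def funpow.simps o_apply
    by (intro has_vector_derivative_vec Dt_along_curve differential_Dt_funpow u)
      (use A in \<open>auto simp: differential_vector_def\<close>)
  show "smooth (\<lambda>t. A (prolong u t))"
    using derivative_family_smooth[of ?U 0, OF U] by simp
  show "(time_deriv ^^ k) (\<lambda>t. A (prolong u t)) t = prolong_vector A (prolong u t) k"
    using derivative_family_unique[of ?U k, OF U] by simp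
qed

lemma differential_inner:
  assumes "\<And>i. differential_function (\<lambda>x. V x $ i)"
  shows "differential_function (\<lambda>x. complex_of_real (V x \<bullet> b))"
proof -
  have "differential_function (\<lambda>x. \<Sum>i\<in>UNIV. complex_of_real (V x $ i \<bullet> b $ i))"
    by (intro differential_sum differential_linear[OF bounded_linear_of_real_inner] assms)
  then show ?thesis by (simp add: inner_vec_def)
qed

lemma prolong_vector_inner:
  assumes A: "differential_vector A"
  shows "complex_of_real (prolong_vector A x k \<bullet> b) = (Dt ^^ k) (\<lambda>x. complex_of_real (A x \<bullet> b)) x"
proof -
  have A: "differential_function (\<lambda>x. A x $ i)" for i
    using A by (simp add: differential_vector_def)
  have "(Dt ^^ k) (\<lambda>x. complex_of_real (A x \<bullet> b)) x
      = (Dt ^^ k) (\<lambda>x. \<Sum>i\<in>UNIV. complex_of_real (A x $ i \<bullet> b $ i)) x"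
    by (simp add: inner_vec_def)
  also have "\<dots> = (\<Sum>i\<in>UNIV. (Dt ^^ k) (\<lambda>x. complex_of_real (A x $ i \<bullet> b $ i)) x)"
    by (intro Dt_funpow_sum differential_linear[OF bounded_linear_of_real_inner] A finite)
  also have "\<dots> = (\<Sum>i\<in>UNIV. complex_of_real ((Dt ^^ k) (\<lambda>x. A x $ i) x \<bullet> b $ i))"
    by (simp add: Dt_funpow_linear[OF bounded_linear_of_real_inner A])
  finally show ?thesis
    by (simp add: inner_vec_def prolong_vector_def)
qed

lemma differential_evolution:
  assumes f: "differential_function f" and A: "differential_vector A"
  shows "differential_function (\<lambda>x. dir_deriv f 0 (prolong_vector A x) x)"
proof (rule differential_dir_deriv_along[OF f], rule differential_inner)
  show "differential_function (\<lambda>x. prolong_vector A x k $ i)" for k i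
    using A by (simp add: prolong_vector_def differential_vector_def differential_Dt_funpow)
qed


section \<open>The first variation and the gradient\<close>

definition curve_jet :: "(real \<Rightarrow> complex ^ 4) \<Rightarrow> real \<Rightarrow> nat \<Rightarrow> complex ^ 4" where
  "curve_jet \<phi> t = (\<lambda>k. (time_deriv ^^ k) \<phi> t)"

text \<open>
  The complex-bilinear pairing of the variational calculus, in contrast to the real inner product
  \<open>\<bullet>\<close>, which serves to extract real coordinates.
\<close>

definition cdot :: "complex ^ 4 \<Rightarrow> complex ^ 4 \<Rightarrow> complex" where
  "cdot v w = (\<Sum>j\<in>UNIV. v $ j * w $ j)"

text \<open>
  The derivative of \<open>P\<close> at the jet \<open>x\<close> along the directions that leave time fixed; it is real-linear
  in \<open>w\<close>.
\<close>

definition linearization :: "(jet \<Rightarrow> complex ^ 4) \<Rightarrow> jet \<Rightarrow> (nat \<Rightarrow> complex ^ 4) \<Rightarrow> complex ^ 4" where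
  "linearization P x w = (\<chi> j. dir_deriv (\<lambda>y. P y $ j) 0 w x)"

lemma cdot_diff_left: "cdot (u - v) w = cdot u w - cdot v w"
  and cdot_add_right: "cdot w (u + v) = cdot w u + cdot w v"
  and cdot_zero_right [simp]: "cdot w 0 = 0"
  and cdot_zero_left [simp]: "cdot 0 w = 0"
  and cdot_commute: "cdot v w = cdot w v"
  by (simp_all add: cdot_def sum.distrib sum_subtractf sum_negf algebra_simps)

lemma cdot_scaleR_right: "cdot w (r *\<^sub>R v) = of_real r * cdot w v"
  by (simp add: cdot_def sum_distrib_left scaleR_conv_of_real[where 'a=complex] mult_ac)

lemma cdot_axis: "cdot v (axis j 1) = v $ j"
  by (simp add: cdot_def axis_def if_distrib cong: if_cong)

lemma cdot_basis_expansion: "(\<Sum>b\<in>Basis. complex_of_real (w \<bullet> b) * cdot v b) = cdot v w"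
proof -
  have "cdot v w = cdot v (\<Sum>b\<in>Basis. (w \<bullet> b) *\<^sub>R b)"
    by (simp add: euclidean_representation)
  also have "\<dots> = (\<Sum>b\<in>Basis. cdot v ((w \<bullet> b) *\<^sub>R b))"
    by (induction rule: finite_induct[OF finite_Basis]) (auto simp: cdot_add_right)
  finally show ?thesis
    by (simp add: cdot_scaleR_right)
qed

lemma differential_cdot:
  "differential_vector A \<Longrightarrow> differential_vector B \<Longrightarrow> differential_function (\<lambda>x. cdot (A x) (B x))"
  unfolding cdot_def differential_vector_def by (intro differential_sum differential_mult) auto

lemma differential_vector_time:
  assumes "smooth \<phi>"
  shows "differential_vector (\<lambda>x. \<phi> (fst x))"
  unfolding differential_vector_def
  by (intro allI differential_time smooth_linear[OF bounded_linear_vec_nth] assms)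

lemma differential_vector_matrix:
  "differential_vector A \<Longrightarrow> differential_vector (\<lambda>x. M *v A x)"
  unfolding differential_vector_def matrix_vector_mult_def
  by (auto intro!: differential_sum differential_mult differential_const)

lemma differential_vector_diff:
  "differential_vector A \<Longrightarrow> differential_vector B \<Longrightarrow> differential_vector (\<lambda>x. A x - B x)"
  unfolding differential_vector_def by (auto intro: differential_diff)

lemma differential_vector_evolution:
  "differential_vector P \<Longrightarrow> differential_vector A \<Longrightarrow> differential_vector (\<lambda>x. linearization P x (prolong_vector A x))"
  unfolding differential_vector_def[of P] differential_vector_def[of "\<lambda>x. linearization P x (prolong_vector A x)"]
  by (simp add: linearization_def differential_evolution)

lemma dir_deriv_cdot:
  assumes "differential_vector A" "differential_vector B"
  shows "dir_deriv (\<lambda>x. cdot (A x) (B x)) 0 w x = cdot (linearization A x w) (B x) + cdot (A x) (linearization B x w)"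
proof -
  have d: "differential_function (\<lambda>x. A x $ j)" "differential_function (\<lambda>x. B x $ j)" for j
    using assms by (auto simp: differential_vector_def)
  have "dir_deriv (\<lambda>x. cdot (A x) (B x)) 0 w x = (\<Sum>j\<in>UNIV. dir_deriv (\<lambda>x. A x $ j * B x $ j) 0 w x)"
    unfolding cdot_def by (intro dir_deriv_sum differential_mult d)
  then show ?thesis
    by (simp add: dir_deriv_mult d cdot_def linearization_def sum.distrib)
qed

lemma linearization_matrix:
  assumes "differential_vector A"
  shows "linearization (\<lambda>x. M *v A x) x w = M *v linearization A x w"
proof -
  have d: "differential_function (\<lambda>x. A x $ j)" for j
    using assms by (auto simp: differential_vector_def)
  have "dir_deriv (\<lambda>x. \<Sum>j\<in>UNIV. M $ i $ j * A x $ j) 0 w x = (\<Sum>j\<in>UNIV. dir_deriv (\<lambda>x. M $ i $ j * A x $ j) 0 w x)" for i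
    by (intro dir_deriv_sum differential_mult differential_const d)
  then show ?thesis
    by (simp add: linearization_def matrix_vector_mult_def vec_eq_iff dir_deriv_mult d differential_const dir_deriv_const)
qed

lemma dir_deriv_zero: "dir_deriv f 0 (\<lambda>k. 0) x = 0"
  by (rule dir_deriv_eqI) (simp add: jet_line_def)

lemma linearization_zero: "linearization P x (\<lambda>k. 0) = 0"
  by (simp add: linearization_def dir_deriv_zero vec_eq_iff)

lemma fst_prolong [simp]: "fst (prolong u t) = t"
  by (simp add: prolong_def)

lemma prolong_add_scaleR:
  assumes "smooth u" "smooth \<phi>"
  shows "prolong (\<lambda>t'. u t' + \<epsilon> *\<^sub>R \<phi> t') t = jet_line (prolong u t) 0 (curve_jet \<phi> t) \<epsilon>"
  using time_deriv_funpow_add_scaleR[OF assms] by (simp add: prolong_def jet_line_def curve_jet_def)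

lemma smooth_add_scaleR: "smooth u \<Longrightarrow> smooth \<phi> \<Longrightarrow> smooth (\<lambda>t. u t + \<epsilon> *\<^sub>R \<phi> t)"
  by (intro smooth_add smooth_linear[OF bounded_linear_scaleR_right])

text \<open>
  A fixed curve enters as explicit time dependence. Regarding the variation along \<open>\<phi>\<close> as a
  differential function of its own allows the first variation formula to be applied to it again.
\<close>

lemma differential_curve_jet:
  assumes "differential_function f" "smooth \<phi>"
  shows "differential_function (\<lambda>x. dir_deriv f 0 (curve_jet \<phi> (fst x)) x)"
  unfolding curve_jet_def
  by (intro differential_dir_deriv_along[OF assms(1)] differential_time
      smooth_linear[OF bounded_linear_of_real_inner] smooth_time_deriv_funpow assms(2))

lemma differential_vector_lin_curve_jet:
  "differential_vector P \<Longrightarrow> smooth \<phi> \<Longrightarrow> differential_vector (\<lambda>x. linearization P x (curve_jet \<phi> (fst x)))"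
  by (simp add: differential_vector_def linearization_def differential_curve_jet)

lemma continuous_on_prolong:
  "differential_function f \<Longrightarrow> smooth u \<Longrightarrow> continuous_on S (\<lambda>t. f (prolong u t))"
  by (intro smooth_continuous_on smooth_along_curve)

text \<open>
  Differentiation under the integral sign. The coordinate expansion supplies the joint continuity
  of the derivative in \<open>\<epsilon>\<close> and \<open>t\<close>.
\<close>

lemma first_variation_interval:
  assumes f: "differential_function f" and u: "smooth u" and \<phi>: "smooth \<phi>"
  shows "((\<lambda>\<epsilon>. integral {a..b} (\<lambda>t. f (prolong (\<lambda>t'. u t' + \<epsilon> *\<^sub>R \<phi> t') t))) has_vector_derivative
    integral {a..b} (\<lambda>t. dir_deriv f 0 (curve_jet \<phi> t) (prolong u t))) (at 0)"
proof -
  from f obtain N where N: "depends_upto N f"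
    by (auto simp: differential_function_iff)
  let ?p = "\<lambda>\<epsilon> t. jet_line (prolong u t) 0 (curve_jet \<phi> t) \<epsilon>"
  have p_cont: "continuous_on S (\<lambda>(\<epsilon>, t). ?p \<epsilon> t)" for S
    unfolding split_beta jet_line_def prolong_def curve_jet_def fst_conv snd_conv
    by (intro continuous_intros continuous_on_compose2[of UNIV, OF smooth_continuous_on]
        smooth_time_deriv_funpow u \<phi>) auto
  have cont: "continuous_on (UNIV \<times> cbox a b) (\<lambda>(\<epsilon>, t). dir_deriv f 0 (curve_jet \<phi> t) (?p \<epsilon> t))"
  proof -
    have "continuous_on (UNIV \<times> cbox a b) (\<lambda>x. g (?p (fst x) (snd x)))"
      if "differential_function g" for g
      using continuous_on_compose2[OF differential_continuous[OF that, of UNIV] p_cont[of "UNIV \<times> cbox a b"]]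
      by (simp add: split_beta)
    moreover have "continuous_on (UNIV \<times> cbox a b) (\<lambda>x::real \<times> real. curve_jet \<phi> (snd x) k \<bullet> c)" for k c
      unfolding curve_jet_def
      by (intro continuous_intros continuous_on_compose2[of UNIV, OF smooth_continuous_on]
          smooth_time_deriv_funpow \<phi>) auto
    moreover have expand: "dir_deriv f 0 (curve_jet \<phi> t) y =
        (\<Sum>k\<le>N. \<Sum>c\<in>Basis. (curve_jet \<phi> t k \<bullet> c) *\<^sub>R dir_deriv f 0 (unit_dir k c) y)" for t y
      using dir_deriv_expand[OF f N, of 0 "curve_jet \<phi> t" y] by simp
    ultimately show ?thesis
      unfolding split_beta expand
      by (intro continuous_on_sum continuous_on_scaleR) (auto intro: differential_dir_deriv f)
  qed
  have "((\<lambda>\<epsilon>. integral (cbox a b) (\<lambda>t. f (?p \<epsilon> t))) has_vector_derivative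
    integral (cbox a b) (\<lambda>t. dir_deriv f 0 (curve_jet \<phi> t) (?p 0 t))) (at 0 within UNIV)"
  proof (rule leibniz_rule_vector_derivative[OF _ _ cont])
    show "((\<lambda>\<epsilon>. f (?p \<epsilon> t)) has_vector_derivative dir_deriv f 0 (curve_jet \<phi> t) (?p \<epsilon> t)) (at \<epsilon> within UNIV)" for \<epsilon> t
      using jet_line_derivative_at[OF differential_has_dir_deriv[OF f]] by simp
    show "(\<lambda>t. f (?p \<epsilon> t)) integrable_on cbox a b" for \<epsilon>
      unfolding prolong_add_scaleR[OF u \<phi>, symmetric]
      by (intro integrable_continuous continuous_on_prolong f smooth_add_scaleR u \<phi>)
  qed auto
  then show ?thesis
    by (simp add: prolong_add_scaleR[OF u \<phi>])
qed

lemma test_curve_smooth: "test_curve \<phi> \<Longrightarrow> smooth \<phi>"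
  by (simp add: test_curve_def smooth_curve_iff_smooth)

lemma test_curve_curve_jet:
  assumes "test_curve \<phi>"
  obtains a b where "a < b" and "\<And>t. t \<notin> {a<..<b} \<Longrightarrow> curve_jet \<phi> t = (\<lambda>k. 0)"
    and "\<And>t. t \<notin> {a<..<b} \<Longrightarrow> \<phi> t = 0"
proof -
  obtain a b where ab: "a < b" and 0: "\<And>t k. t \<notin> {a<..<b} \<Longrightarrow> (time_deriv ^^ k) \<phi> t = 0"
    by (rule test_curve_support[OF assms]) blast
  show ?thesis
  proof (rule that[OF ab])
    show "\<phi> t = 0" if "t \<notin> {a<..<b}" for t
      using 0[OF that, of 0] by simp
  qed (simp add: curve_jet_def 0)
qed

lemma jet_line_zero [simp]: "jet_line x 0 (\<lambda>k. 0) h = x"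
  by (simp add: jet_line_def)

lemma first_variation:
  assumes f: "differential_function f" and u: "smooth u" and \<phi>: "test_curve \<phi>"
  shows "((\<lambda>\<epsilon>. integral UNIV (\<lambda>t. f (prolong (\<lambda>t'. u t' + \<epsilon> *\<^sub>R \<phi> t') t) - f (prolong u t)))
    has_vector_derivative integral UNIV (\<lambda>t. dir_deriv f 0 (curve_jet \<phi> t) (prolong u t))) (at 0)"
proof -
  note s = test_curve_smooth[OF \<phi>]
  obtain a b where ab: "a < b" and
    0: "\<And>t. t \<notin> {a<..<b} \<Longrightarrow> curve_jet \<phi> t = (\<lambda>k. 0)" "\<And>t. t \<notin> {a<..<b} \<Longrightarrow> \<phi> t = 0"
    by (rule test_curve_curve_jet[OF \<phi>]) blast
  have 1: "integral UNIV (\<lambda>t. f (prolong (\<lambda>t'. u t' + \<epsilon> *\<^sub>R \<phi> t') t) - f (prolong u t))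
    = integral {a..b} (\<lambda>t. f (prolong (\<lambda>t'. u t' + \<epsilon> *\<^sub>R \<phi> t') t)) - integral {a..b} (\<lambda>t. f (prolong u t))" for \<epsilon>
  proof -
    have "integral UNIV (\<lambda>t. f (prolong (\<lambda>t'. u t' + \<epsilon> *\<^sub>R \<phi> t') t) - f (prolong u t))
      = integral {a..b} (\<lambda>t. f (prolong (\<lambda>t'. u t' + \<epsilon> *\<^sub>R \<phi> t') t) - f (prolong u t))"
      by (rule integral_UNIV_eq_interval) (simp add: prolong_add_scaleR[OF u s] 0)
    also have "\<dots> = integral {a..b} (\<lambda>t. f (prolong (\<lambda>t'. u t' + \<epsilon> *\<^sub>R \<phi> t') t)) - integral {a..b} (\<lambda>t. f (prolong u t))"
      by (intro Henstock_Kurzweil_Integration.integral_diff integrable_continuous_real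
          continuous_on_prolong smooth_add_scaleR f u s)
    finally show ?thesis .
  qed
  have 2: "integral UNIV (\<lambda>t. dir_deriv f 0 (curve_jet \<phi> t) (prolong u t))
    = integral {a..b} (\<lambda>t. dir_deriv f 0 (curve_jet \<phi> t) (prolong u t))"
    by (rule integral_UNIV_eq_interval) (simp add: 0 dir_deriv_zero)
  show ?thesis
    unfolding 1 2
    using has_vector_derivative_diff[OF first_variation_interval[OF f u s, of a b] has_vector_derivative_const]
    by simp
qed

text \<open>
  With the first variation computed, having a gradient becomes an integral identity that no longer
  contains \<open>\<epsilon>\<close>. In this form it can be varied once more, and verified for the density of a bracket.
\<close>

lemma has_gradient_iff:
  assumes "differential_function f"
  shows "has_gradient f P \<longleftrightarrow> differential_vector P \<and>
    (\<forall>u \<phi>. smooth u \<longrightarrow> test_curve \<phi> \<longrightarrow>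
      integral UNIV (\<lambda>t. dir_deriv f 0 (curve_jet \<phi> t) (prolong u t)) =
      integral UNIV (\<lambda>t. cdot (P (prolong u t)) (\<phi> t)))"
proof -
  have "((\<lambda>\<epsilon>. integral UNIV (\<lambda>t. f (prolong (\<lambda>t'. u t' + \<epsilon> *\<^sub>R \<phi> t') t) - f (prolong u t)))
      has_vector_derivative c) (at 0) \<longleftrightarrow> integral UNIV (\<lambda>t. dir_deriv f 0 (curve_jet \<phi> t) (prolong u t)) = c"
    if "smooth u" "test_curve \<phi>" for u \<phi> c
    using first_variation[OF assms that] vector_derivative_unique_at by blast
  then show ?thesis
    unfolding has_gradient_def differential_vector_def cdot_def smooth_curve_iff_smooth by simp
qed

text \<open>
  The fundamental lemma gives vanishing along every smooth curve, and every finite jet lies on a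
  smooth curve.
\<close>

lemma weak_zero:
  assumes g: "differential_function g"
    and zero: "\<And>u \<eta> a b. smooth u \<Longrightarrow> smooth \<eta> \<Longrightarrow> (\<And>t. t \<notin> {a<..<b} \<Longrightarrow> \<eta> t = 0) \<Longrightarrow>
      integral UNIV (\<lambda>t. complex_of_real (\<eta> t) * g (prolong u t)) = 0"
  shows "g x = 0"
proof -
  from g obtain N where N: "depends_upto N g"
    by (auto simp: differential_function_iff)
  obtain u where u: "smooth u" "\<And>k. k \<le> N \<Longrightarrow> (time_deriv ^^ k) u (fst x) = snd x k"
    by (rule jet_attained[where N=N and s="fst x" and z="snd x"]) blast
  have "g (prolong u (fst x)) = 0"
    by (rule fundamental_lemma[OF continuous_on_prolong[OF g u(1)]]) (rule zero[OF u(1)])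
  moreover have "g (prolong u (fst x)) = g x"
    by (rule depends_uptoD[OF N]) (auto simp: prolong_def u(2))
  ultimately show ?thesis by simp
qed

lemma integrable_UNIV_compact_support:
  fixes g :: "real \<Rightarrow> 'a::euclidean_space"
  assumes "continuous_on UNIV g" "\<And>t. t \<notin> {a<..<b} \<Longrightarrow> g t = 0"
  shows "g integrable_on UNIV"
proof -
  have "g = (\<lambda>t. if t \<in> {a..b} then g t else 0)"
    using assms(2) by force
  moreover have "g integrable_on {a..b}"
    by (intro integrable_continuous_real continuous_on_subset[OF assms(1)]) auto
  ultimately show ?thesis
    by (metis integrable_restrict_UNIV)
qed

lemma test_curve_scaleR:
  assumes "smooth \<eta>" "\<And>t. t \<notin> {a<..<b} \<Longrightarrow> \<eta> t = 0" "smooth v"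
  shows "test_curve (\<lambda>t. \<eta> t *\<^sub>R v t)"
  unfolding test_curve_def smooth_curve_iff_smooth
proof
  show "smooth (\<lambda>t. \<eta> t *\<^sub>R v t)"
    by (intro smooth_bilinear[OF bounded_bilinear_scaleR] assms)
  show "\<exists>a b. \<forall>t. t \<notin> {a..b} \<longrightarrow> \<eta> t *\<^sub>R v t = 0"
    using assms(2) by (intro exI[of _ a] exI[of _ b]) auto
qed

lemma has_gradient_unique:
  assumes P: "has_gradient f P" and Q: "has_gradient f Q"
  shows "P = Q"
proof -
  have dv: "differential_vector P" "differential_vector Q"
    using P Q by (auto simp: has_gradient_def differential_vector_def)
  have eq: "integral UNIV (\<lambda>t. cdot (P (prolong u t)) (\<phi> t)) = integral UNIV (\<lambda>t. cdot (Q (prolong u t)) (\<phi> t))"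
    if "smooth u" "test_curve \<phi>" for u \<phi>
    using P Q that unfolding has_gradient_def smooth_curve_iff_smooth cdot_def
    by (blast intro: vector_derivative_unique_at)
  have "P x $ j - Q x $ j = 0" for x j
  proof (rule weak_zero[of "\<lambda>x. P x $ j - Q x $ j"])
    show "differential_function (\<lambda>x. P x $ j - Q x $ j)"
      using dv by (auto simp: differential_vector_def intro: differential_diff)
    fix u :: "real \<Rightarrow> complex ^ 4" and \<eta> :: "real \<Rightarrow> real" and a b
    assume *: "smooth u" "smooth \<eta>" "\<And>t. t \<notin> {a<..<b} \<Longrightarrow> \<eta> t = 0"
    have int: "(\<lambda>t. complex_of_real (\<eta> t) * R (prolong u t) $ j) integrable_on UNIV"
      if "differential_vector R" for R
    proof (rule integrable_UNIV_compact_support[of _ a b])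
      show "continuous_on UNIV (\<lambda>t. complex_of_real (\<eta> t) * R (prolong u t) $ j)"
        by (rule continuous_on_mult[OF continuous_on_of_real[OF smooth_continuous_on[OF *(2)]]
              continuous_on_prolong[OF that[unfolded differential_vector_def, rule_format] *(1)]])
    qed (simp add: *(3))
    have "integral UNIV (\<lambda>t. complex_of_real (\<eta> t) * P (prolong u t) $ j)
        = integral UNIV (\<lambda>t. complex_of_real (\<eta> t) * Q (prolong u t) $ j)"
      using eq[OF *(1) test_curve_scaleR[OF *(2,3) smooth_const[of "axis j 1"]]]
      by (simp add: cdot_scaleR_right cdot_axis)
    then show "integral UNIV (\<lambda>t. complex_of_real (\<eta> t) * (P (prolong u t) $ j - Q (prolong u t) $ j)) = 0"
      unfolding right_diff_distrib
      by (subst Henstock_Kurzweil_Integration.integral_diff[OF int[OF dv(1)] int[OF dv(2)]]) simp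
  qed
  then show ?thesis
    by (simp add: vec_eq_iff fun_eq_iff)
qed

text \<open>
  By the fundamental theorem of calculus the integral depends on the jets at two points outside the
  support of \<open>\<phi>\<close> only, where the varied curve and the original one agree.
\<close>

lemma total_derivative_no_variation:
  assumes k: "total_derivative k" "differential_function k" and u: "smooth u" and \<phi>: "test_curve \<phi>"
  shows "integral UNIV (\<lambda>t. k (prolong (\<lambda>t'. u t' + \<epsilon> *\<^sub>R \<phi> t') t) - k (prolong u t)) = 0"
proof -
  from k(1) obtain h where h: "\<And>v t. smooth v \<Longrightarrow>
      ((\<lambda>t. h (prolong v t)) has_vector_derivative k (prolong v t)) (at t)"
    by (auto simp: total_derivative_def smooth_curve_iff_smooth)
  note s = test_curve_smooth[OF \<phi>]
  obtain a b where ab: "a < b" and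
    0: "\<And>t. t \<notin> {a<..<b} \<Longrightarrow> curve_jet \<phi> t = (\<lambda>k. 0)" "\<And>t. t \<notin> {a<..<b} \<Longrightarrow> \<phi> t = 0"
    by (rule test_curve_curve_jet[OF \<phi>]) blast
  let ?v = "\<lambda>t'. u t' + \<epsilon> *\<^sub>R \<phi> t'"
  have v: "smooth ?v"
    by (rule smooth_add_scaleR[OF u s])
  have eq: "prolong ?v t = prolong u t" if "t \<notin> {a<..<b}" for t
    using that by (simp add: prolong_add_scaleR[OF u s] 0)
  have "((\<lambda>t. k (prolong w t)) has_integral h (prolong w b) - h (prolong w a)) {a..b}" if "smooth w" for w
    using ab h[OF that]
    by (intro fundamental_theorem_of_calculus) (auto intro: has_vector_derivative_at_within)
  from has_integral_diff[OF this[OF v] this[OF u]]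
  have "integral {a..b} (\<lambda>t. k (prolong ?v t) - k (prolong u t)) = 0"
    by (simp add: eq integral_unique)
  then show ?thesis
    using integral_UNIV_eq_interval[of a b "\<lambda>t. k (prolong ?v t) - k (prolong u t)"] by (simp add: eq)
qed

lemma has_gradient_cong:
  assumes g: "differential_function g" and f: "differential_function f"
    and td: "total_derivative (\<lambda>x. g x - f x)" and P: "has_gradient g P"
  shows "has_gradient f P"
proof -
  have "integral UNIV (\<lambda>t. f (prolong (\<lambda>t'. u t' + \<epsilon> *\<^sub>R \<phi> t') t) - f (prolong u t))
      = integral UNIV (\<lambda>t. g (prolong (\<lambda>t'. u t' + \<epsilon> *\<^sub>R \<phi> t') t) - g (prolong u t))"
    if u: "smooth u" and \<phi>: "test_curve \<phi>" for u \<phi> \<epsilon>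
  proof -
    note s = test_curve_smooth[OF \<phi>]
    obtain a b where ab: "a < b" and
    0: "\<And>t. t \<notin> {a<..<b} \<Longrightarrow> curve_jet \<phi> t = (\<lambda>k. 0)" "\<And>t. t \<notin> {a<..<b} \<Longrightarrow> \<phi> t = 0"
    by (rule test_curve_curve_jet[OF \<phi>]) blast
    let ?v = "\<lambda>t'. u t' + \<epsilon> *\<^sub>R \<phi> t'"
    have int: "(\<lambda>t. k (prolong ?v t) - k (prolong u t)) integrable_on UNIV"
      if "differential_function k" for k
      by (rule integrable_UNIV_compact_support[of _ a b], intro continuous_on_diff continuous_on_prolong
          smooth_add_scaleR that u s) (simp add: prolong_add_scaleR[OF u s] 0)
    show ?thesis
      using total_derivative_no_variation[OF td differential_diff[OF g f] u \<phi>, of \<epsilon>]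
        Henstock_Kurzweil_Integration.integral_diff[OF int[OF g] int[OF f]]
      by (simp add: algebra_simps)
  qed
  with P show ?thesis
    unfolding has_gradient_def smooth_curve_iff_smooth by simp
qed

lemma total_derivative_zero: "total_derivative (\<lambda>x. 0)"
  unfolding total_derivative_def
  by (intro exI[of _ "\<lambda>x. 0"]) (auto intro: differential_const)

lemma gradient_functional_of:
  assumes f: "differential_function f" and P: "has_gradient f P"
  shows "gradient (functional_of f) = P"
  unfolding gradient_def
proof (rule the_equality)
  have "f \<in> functional_of f"
    using f total_derivative_zero by (simp add: functional_of_def)
  with P show "\<exists>g\<in>functional_of f. has_gradient g P" by blast
  fix Q assume "\<exists>g\<in>functional_of f. has_gradient g Q"
  then obtain g where "differential_function g" "total_derivative (\<lambda>x. g x - f x)" "has_gradient g Q"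
    by (auto simp: functional_of_def)
  then have "has_gradient f Q"
    using has_gradient_cong f by blast
  then show "Q = P"
    using P has_gradient_unique by blast
qed


section \<open>Gradients are formally self-adjoint\<close>

text \<open>
  Integrate \<open>B = \<partial>F/\<partial>r\<close> from \<open>-1\<close> to \<open>r\<close> and differentiate in \<open>s\<close> under the integral: this expresses
  \<open>A = \<partial>F/\<partial>s\<close> at \<open>s = 0\<close>, up to the constant \<open>A (-1)\<close>, as the integral of \<open>M = \<partial>B/\<partial>s\<close>, and the
  fundamental theorem of calculus gives the derivative of \<open>A\<close>.
\<close>

lemma mixed_partials_eq:
  fixes F :: "real \<Rightarrow> real \<Rightarrow> 'a::euclidean_space"
  assumes A: "\<And>r. ((\<lambda>s. F s r) has_vector_derivative A r) (at 0)"
    and B: "\<And>s r. ((\<lambda>r. F s r) has_vector_derivative B s r) (at r)"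
    and M: "\<And>s r. ((\<lambda>s. B s r) has_vector_derivative M s r) (at s)"
    and M_cont: "continuous_on UNIV (\<lambda>(s, r). M s r)"
    and B_cont: "\<And>s. continuous_on UNIV (B s)"
    and K: "(A has_vector_derivative K) (at 0)"
  shows "K = M 0 0"
proof -
  have FTC: "integral {-1..r} (B s) = F s r - F s (-1)" if "-1 \<le> r" for s r
    by (rule integral_unique[OF fundamental_theorem_of_calculus[OF that has_vector_derivative_at_within[OF B]]])
  have A_eq: "A r = A (-1) + integral {-1..r} (M 0)" if "-1 \<le> r" for r
  proof -
    have "((\<lambda>s. integral (cbox (-1) r) (B s)) has_vector_derivative integral (cbox (-1) r) (M 0)) (at 0 within UNIV)"
    proof (rule leibniz_rule_vector_derivative)
      show "((\<lambda>s. B s q) has_vector_derivative M s q) (at s within UNIV)" for s q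
        using M by simp
      show "B s integrable_on cbox (-1) r" for s
        by (rule integrable_continuous[OF continuous_on_subset[OF B_cont subset_UNIV]])
      show "continuous_on (UNIV \<times> cbox (-1) r) (\<lambda>(s, q). M s q)"
        by (rule continuous_on_subset[OF M_cont subset_UNIV])
    qed auto
    then have "((\<lambda>s. F s r - F s (-1)) has_vector_derivative integral {-1..r} (M 0)) (at 0)"
      using that by (simp add: FTC)
    moreover have "((\<lambda>s. F s r - F s (-1)) has_vector_derivative A r - A (-1)) (at 0)"
      by (intro has_vector_derivative_diff A)
    ultimately have "integral {-1..r} (M 0) = A r - A (-1)"
      by (rule vector_derivative_unique_at)
    then show ?thesis by simp
  qed
  have "continuous_on {-1..1} (M 0)"
    using continuous_on_compose2[OF M_cont continuous_on_Pair[OF continuous_on_const continuous_on_id]]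
    by simp
  then have "((\<lambda>r. integral {-1..r} (M 0)) has_vector_derivative M 0 0) (at 0 within {-1..1})"
    by (rule integral_has_vector_derivative) auto
  then have "((\<lambda>r. integral {-1..r} (M 0)) has_vector_derivative M 0 0) (at 0)"
    by (simp add: at_within_Icc_at)
  from has_vector_derivative_add[OF has_vector_derivative_const this]
  have "((\<lambda>r. A (-1) + integral {-1..r} (M 0)) has_vector_derivative M 0 0) (at 0)"
    by simp
  then have "(A has_vector_derivative M 0 0) (at 0)"
    by (rule has_vector_derivative_transform_within_open[where S="{-1<..<1}"])
      (simp_all add: A_eq[symmetric])
  with K show ?thesis
    by (rule vector_derivative_unique_at)
qed

lemma dir_deriv_commute:
  assumes f: "differential_function f"
  shows "dir_deriv (dir_deriv f \<sigma> v) \<tau> w x = dir_deriv (dir_deriv f \<tau> w) \<sigma> v x"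
proof -
  let ?p = "\<lambda>s r. jet_line (jet_line x \<sigma> v s) \<tau> w r"
  have swap: "?p s r = jet_line (jet_line x \<tau> w r) \<sigma> v s" for s r
    by (simp add: jet_line_def algebra_simps)
  have cont: "continuous_on S (\<lambda>(s, r). h (?p s r))" if "differential_function h" for S h
    unfolding split_beta
    by (rule continuous_on_compose2[OF differential_continuous[OF that, of UNIV]])
      (auto simp: jet_line_def intro!: continuous_intros)
  have "dir_deriv (dir_deriv f \<sigma> v) \<tau> w x = dir_deriv (dir_deriv f \<tau> w) \<sigma> v (?p 0 0)"
  proof (rule mixed_partials_eq[where F="\<lambda>s r. f (?p s r)" and A="\<lambda>r. dir_deriv f \<sigma> v (?p 0 r)"
        and B="\<lambda>s r. dir_deriv f \<tau> w (?p s r)"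
        and M="\<lambda>s r. dir_deriv (dir_deriv f \<tau> w) \<sigma> v (?p s r)"])
    show "((\<lambda>s. f (?p s r)) has_vector_derivative dir_deriv f \<sigma> v (?p 0 r)) (at 0)" for r
      unfolding swap using differential_has_dir_deriv[OF f] by simp
    show "((\<lambda>r. f (?p s r)) has_vector_derivative dir_deriv f \<tau> w (?p s r)) (at r)" for s r
      by (rule jet_line_derivative_at[OF differential_has_dir_deriv[OF f]])
    show "((\<lambda>s. dir_deriv f \<tau> w (?p s r)) has_vector_derivative dir_deriv (dir_deriv f \<tau> w) \<sigma> v (?p s r)) (at s)" for s r
      unfolding swap by (rule jet_line_derivative_at[OF differential_has_dir_deriv[OF differential_dir_deriv[OF f]]])
    show "continuous_on UNIV (\<lambda>(s, r). dir_deriv (dir_deriv f \<tau> w) \<sigma> v (?p s r))"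
      by (intro cont differential_dir_deriv f)
    show "continuous_on UNIV (\<lambda>r. dir_deriv f \<tau> w (?p s r))" for s
      by (rule continuous_on_compose2[OF differential_continuous[OF differential_dir_deriv[OF f], of UNIV]])
        (auto simp: jet_line_def intro!: continuous_intros)
    show "((\<lambda>r. dir_deriv f \<sigma> v (?p 0 r)) has_vector_derivative dir_deriv (dir_deriv f \<sigma> v) \<tau> w x) (at 0)"
      using differential_has_dir_deriv[OF differential_dir_deriv[OF f]] by simp
  qed
  then show ?thesis by simp
qed

text \<open>
  Vary the curve \<open>u\<close> in the direction \<open>\<psi>\<close> in the gradient identity for \<open>\<phi>\<close>. Both sides are integrals of
  differential functions with explicit time dependence, so the first variation formula applies to
  each of them.
\<close>

lemma second_variation:
  assumes f: "differential_function f" and P: "has_gradient f P"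
    and u: "smooth u" and \<phi>: "test_curve \<phi>" and \<psi>: "smooth \<psi>"
  shows "integral UNIV (\<lambda>t. dir_deriv (dir_deriv f 0 (curve_jet \<phi> t)) 0 (curve_jet \<psi> t) (prolong u t)) =
    integral UNIV (\<lambda>t. cdot (linearization P (prolong u t) (curve_jet \<psi> t)) (\<phi> t))"
proof -
  note s = test_curve_smooth[OF \<phi>]
  have dP: "differential_vector P"
    using P by (simp add: has_gradient_iff[OF f])
  obtain a b where ab: "a < b" and
    0: "\<And>t. t \<notin> {a<..<b} \<Longrightarrow> curve_jet \<phi> t = (\<lambda>k. 0)" "\<And>t. t \<notin> {a<..<b} \<Longrightarrow> \<phi> t = 0"
    by (rule test_curve_curve_jet[OF \<phi>]) blast
  let ?L = "\<lambda>x. dir_deriv f 0 (curve_jet \<phi> (fst x)) x" and ?R = "\<lambda>x. cdot (P x) (\<phi> (fst x))"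
  have L: "differential_function ?L"
    by (rule differential_curve_jet[OF f s])
  have R: "differential_function ?R"
    by (rule differential_cdot[OF dP differential_vector_time[OF s]])
  have "integral {a..b} (\<lambda>t. ?L (prolong v t)) = integral {a..b} (\<lambda>t. ?R (prolong v t))" if "smooth v" for v
  proof -
    have "integral UNIV (\<lambda>t. ?L (prolong v t)) = integral UNIV (\<lambda>t. ?R (prolong v t))"
      using P that \<phi> by (simp add: has_gradient_iff[OF f])
    moreover have "integral UNIV (\<lambda>t. ?L (prolong v t)) = integral {a..b} (\<lambda>t. ?L (prolong v t))"
      by (rule integral_UNIV_eq_interval) (simp add: 0 dir_deriv_zero)
    moreover have "integral UNIV (\<lambda>t. ?R (prolong v t)) = integral {a..b} (\<lambda>t. ?R (prolong v t))"
      by (rule integral_UNIV_eq_interval) (simp add: 0)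
    ultimately show ?thesis by simp
  qed
  then have "integral {a..b} (\<lambda>t. dir_deriv ?L 0 (curve_jet \<psi> t) (prolong u t))
      = integral {a..b} (\<lambda>t. dir_deriv ?R 0 (curve_jet \<psi> t) (prolong u t))"
    using first_variation_interval[OF L u \<psi>, of a b] first_variation_interval[OF R u \<psi>, of a b]
    by (simp add: smooth_add_scaleR[OF u \<psi>] vector_derivative_unique_at)
  moreover have "dir_deriv ?L 0 w x = dir_deriv (dir_deriv f 0 (curve_jet \<phi> (fst x))) 0 w x" for w x
    by (simp add: dir_deriv_def[of ?L] dir_deriv_def[of "dir_deriv f 0 (curve_jet \<phi> (fst x))"] jet_line_def)
  moreover have "dir_deriv ?R 0 w x = cdot (linearization P x w) (\<phi> (fst x))" for w x
  proof -
    have "linearization (\<lambda>x. \<phi> (fst x)) x w = 0"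
      by (simp add: linearization_def vec_eq_iff) (intro allI dir_deriv_eqI, simp add: jet_line_def)
    then show ?thesis
      by (simp add: dir_deriv_cdot[OF dP differential_vector_time[OF s]])
  qed
  moreover have "integral UNIV (\<lambda>t. dir_deriv (dir_deriv f 0 (curve_jet \<phi> t)) 0 (curve_jet \<psi> t) (prolong u t))
      = integral {a..b} (\<lambda>t. dir_deriv (dir_deriv f 0 (curve_jet \<phi> t)) 0 (curve_jet \<psi> t) (prolong u t))"
  proof (rule integral_UNIV_eq_interval)
    fix t assume "t \<notin> {a<..<b}"
    moreover have "dir_deriv f 0 (\<lambda>k. 0) = (\<lambda>x. 0)"
      by (simp add: dir_deriv_zero fun_eq_iff)
    ultimately show "dir_deriv (dir_deriv f 0 (curve_jet \<phi> t)) 0 (curve_jet \<psi> t) (prolong u t) = 0"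
      by (simp add: 0 dir_deriv_const)
  qed
  moreover have "integral UNIV (\<lambda>t. cdot (linearization P (prolong u t) (curve_jet \<psi> t)) (\<phi> t))
      = integral {a..b} (\<lambda>t. cdot (linearization P (prolong u t) (curve_jet \<psi> t)) (\<phi> t))"
    by (rule integral_UNIV_eq_interval) (simp add: 0)
  ultimately show ?thesis by simp
qed

text \<open>
  Self-adjointness of the linearization (the Helmholtz condition) in weak form. The curve
  \<open>\<psi>\<close> ranges over all smooth curves because it will be the value of a differential vector along
  \<open>u\<close>, which has no compact support in general.
\<close>

definition self_adjoint :: "(jet \<Rightarrow> complex ^ 4) \<Rightarrow> bool" where
  "self_adjoint P \<longleftrightarrow> (\<forall>u \<phi> \<psi>. smooth u \<longrightarrow> test_curve \<phi> \<longrightarrow> smooth \<psi> \<longrightarrow>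
     integral UNIV (\<lambda>t. cdot (linearization P (prolong u t) (curve_jet \<phi> t)) (\<psi> t)) =
     integral UNIV (\<lambda>t. cdot (linearization P (prolong u t) (curve_jet \<psi> t)) (\<phi> t)))"

text \<open>
  For two test curves this is the symmetry of the second variation. A general \<open>\<psi>\<close> is multiplied by
  a cutoff that equals 1 on the support of \<open>\<phi>\<close>; by locality this changes neither integral.
\<close>

lemma gradient_self_adjoint:
  assumes f: "differential_function f" and P: "has_gradient f P"
  shows "self_adjoint P"
  unfolding self_adjoint_def
proof safe
  fix u \<phi> \<psi> :: "real \<Rightarrow> complex ^ 4"
  assume u: "smooth u" and \<phi>: "test_curve \<phi>" and \<psi>: "smooth \<psi>"
  obtain a b where ab: "a < b" and
    0: "\<And>t. t \<notin> {a<..<b} \<Longrightarrow> curve_jet \<phi> t = (\<lambda>k. 0)" "\<And>t. t \<notin> {a<..<b} \<Longrightarrow> \<phi> t = 0"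
    by (rule test_curve_curve_jet[OF \<phi>]) blast
  obtain \<rho> :: "real \<Rightarrow> real" where \<rho>: "smooth \<rho>" "\<And>t. t \<in> {a..b} \<Longrightarrow> \<rho> t = 1"
    "\<And>t. t \<notin> {a - 1..b + 1} \<Longrightarrow> \<rho> t = 0"
    by (rule smooth_plateau) blast
  define \<psi>' where "\<psi>' = (\<lambda>t. \<rho> t *\<^sub>R \<psi> t)"
  have \<psi>': "test_curve \<psi>'"
    unfolding \<psi>'_def by (rule test_curve_scaleR[OF \<rho>(1) _ \<psi>, of "a - 2" "b + 2"]) (use \<rho>(3) in auto)
  have jets: "curve_jet \<psi>' t = curve_jet \<psi> t" if "t \<in> {a<..<b}" for t
    unfolding curve_jet_def \<psi>'_def
    using time_deriv_funpow_local[of "{a<..<b}" "\<lambda>t. \<rho> t *\<^sub>R \<psi> t" \<psi>] that \<rho>(2) by fastforce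
  have "integral UNIV (\<lambda>t. cdot (linearization P (prolong u t) (curve_jet \<phi> t)) (\<psi> t))
      = integral UNIV (\<lambda>t. cdot (linearization P (prolong u t) (curve_jet \<phi> t)) (\<psi>' t))"
  proof (rule arg_cong[where f="integral UNIV"], rule ext)
    fix t show "cdot (linearization P (prolong u t) (curve_jet \<phi> t)) (\<psi> t) = cdot (linearization P (prolong u t) (curve_jet \<phi> t)) (\<psi>' t)"
      by (cases "t \<in> {a<..<b}") (auto simp: 0 linearization_zero \<psi>'_def \<rho>(2))
  qed
  also have "\<dots> = integral UNIV (\<lambda>t. dir_deriv (dir_deriv f 0 (curve_jet \<psi>' t)) 0 (curve_jet \<phi> t) (prolong u t))"
    by (rule second_variation[OF f P u \<psi>' test_curve_smooth[OF \<phi>], symmetric])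
  also have "\<dots> = integral UNIV (\<lambda>t. dir_deriv (dir_deriv f 0 (curve_jet \<phi> t)) 0 (curve_jet \<psi>' t) (prolong u t))"
    by (rule arg_cong[where f="integral UNIV"], rule ext, rule dir_deriv_commute[OF f])
  also have "\<dots> = integral UNIV (\<lambda>t. cdot (linearization P (prolong u t) (curve_jet \<psi>' t)) (\<phi> t))"
    by (rule second_variation[OF f P u \<phi> test_curve_smooth[OF \<psi>']])
  also have "\<dots> = integral UNIV (\<lambda>t. cdot (linearization P (prolong u t) (curve_jet \<psi> t)) (\<phi> t))"
  proof (rule arg_cong[where f="integral UNIV"], rule ext)
    fix t show "cdot (linearization P (prolong u t) (curve_jet \<psi>' t)) (\<phi> t) = cdot (linearization P (prolong u t) (curve_jet \<psi> t)) (\<phi> t)"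
      by (cases "t \<in> {a<..<b}") (auto simp: 0 jets)
  qed
  finally show "integral UNIV (\<lambda>t. cdot (linearization P (prolong u t) (curve_jet \<phi> t)) (\<psi> t)) =
     integral UNIV (\<lambda>t. cdot (linearization P (prolong u t) (curve_jet \<psi> t)) (\<phi> t))" .
qed


section \<open>Total derivatives and formal adjoints\<close>

lemma total_derivative_Dt:
  assumes "differential_function h"
  shows "total_derivative (Dt h)"
  unfolding total_derivative_def smooth_curve_iff_smooth
  using assms Dt_along_curve[OF assms] by blast

lemma total_derivative_add:
  assumes "total_derivative f" "total_derivative g"
  shows "total_derivative (\<lambda>x. f x + g x)"
proof -
  from assms obtain h k where
    h: "differential_function h" "\<And>u t. smooth_curve u \<Longrightarrow>
      ((\<lambda>t. h (prolong u t)) has_vector_derivative f (prolong u t)) (at t)" and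
    k: "differential_function k" "\<And>u t. smooth_curve u \<Longrightarrow>
      ((\<lambda>t. k (prolong u t)) has_vector_derivative g (prolong u t)) (at t)"
    unfolding total_derivative_def by metis
  show ?thesis
    unfolding total_derivative_def
    by (intro exI[of _ "\<lambda>x. h x + k x"] conjI allI impI differential_add
        has_vector_derivative_add h k)
qed

lemma total_derivative_minus:
  assumes "total_derivative f"
  shows "total_derivative (\<lambda>x. - f x)"
proof -
  from assms obtain h where
    h: "differential_function h" "\<And>u t. smooth_curve u \<Longrightarrow>
      ((\<lambda>t. h (prolong u t)) has_vector_derivative f (prolong u t)) (at t)"
    unfolding total_derivative_def by metis
  show ?thesis
    unfolding total_derivative_def
    by (intro exI[of _ "\<lambda>x. - h x"] conjI allI impI differential_minus
        has_vector_derivative_minus h)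
qed

lemma total_derivative_sum:
  "(\<And>i. i \<in> I \<Longrightarrow> total_derivative (f i)) \<Longrightarrow> total_derivative (\<lambda>x. \<Sum>i\<in>I. f i x)"
  by (induction I rule: infinite_finite_induct) (simp_all add: total_derivative_zero total_derivative_add)

text \<open>
  Integration by parts in the formal calculus: move one \<open>Dt\<close> at a time, using
  \<open>c * Dt a' = Dt (c * a') - Dt c * a'\<close>.
\<close>

lemma total_derivative_by_parts:
  assumes "differential_function a" "differential_function c"
  shows "total_derivative (\<lambda>x. c x * (Dt ^^ k) a x - (- 1) ^ k * (Dt ^^ k) c x * a x)"
  using assms(2)
proof (induction k arbitrary: c)
  case 0
  then show ?case by (simp add: total_derivative_zero)
next
  case (Suc k)
  \<comment> \<open>The second summand is the induction hypothesis for \<open>Dt c\<close> in place of \<open>c\<close>.\<close>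
  have "total_derivative (\<lambda>x. Dt (\<lambda>x. c x * (Dt ^^ k) a x) x +
      - (Dt c x * (Dt ^^ k) a x - (- 1) ^ k * (Dt ^^ k) (Dt c) x * a x))"
    by (intro total_derivative_add total_derivative_minus total_derivative_Dt Suc.IH
        differential_mult differential_Dt differential_Dt_funpow assms(1) Suc.prems)
  then show ?case
    by (simp add: Dt_mult Suc.prems differential_Dt_funpow assms(1) funpow_swap1)
qed

text \<open>
  The analytic counterpart of the preceding lemma, for a coordinate of a test curve and a
  differential function evaluated along \<open>u\<close>.
\<close>

lemma integral_by_parts:
  assumes g: "differential_function g" and u: "smooth u" and \<phi>: "test_curve \<phi>"
  shows "integral UNIV (\<lambda>t. complex_of_real (curve_jet \<phi> t k \<bullet> b) * g (prolong u t)) =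
    integral UNIV (\<lambda>t. complex_of_real (\<phi> t \<bullet> b) * ((- 1) ^ k * (Dt ^^ k) g (prolong u t)))"
  using g
proof (induction k arbitrary: g)
  case 0
  then show ?case by (simp add: curve_jet_def)
next
  case (Suc k)
  note s = test_curve_smooth[OF \<phi>]
  obtain a d where ad: "a < d" and
    0: "\<And>t. t \<notin> {a<..<d} \<Longrightarrow> curve_jet \<phi> t = (\<lambda>k. 0)" "\<And>t. t \<notin> {a<..<d} \<Longrightarrow> \<phi> t = 0"
    by (rule test_curve_curve_jet[OF \<phi>]) blast
  let ?e = "\<lambda>k t. complex_of_real (curve_jet \<phi> t k \<bullet> b)"
  have e: "(?e k has_vector_derivative ?e (Suc k) t) (at t)" for t k
    unfolding curve_jet_def
    by (rule bounded_linear.has_vector_derivative[OF bounded_linear_of_real_inner])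
      (rule time_deriv_funpow_has_derivative[OF s])
  have e_cont: "continuous_on S (?e k)" for S k
    using e by (meson continuous_at_imp_continuous_on has_vector_derivative_continuous)
  have int: "(\<lambda>t. ?e k t * h (prolong u t)) integrable_on UNIV" if "differential_function h" for h k
    by (rule integrable_UNIV_compact_support[of _ a d],
        rule continuous_on_mult[OF e_cont continuous_on_prolong[OF that u]]) (simp add: 0)
  have "((\<lambda>t. ?e k t * Dt g (prolong u t) + ?e (Suc k) t * g (prolong u t)) has_integral
      ?e k d * g (prolong u d) - ?e k a * g (prolong u a)) {a..d}"
    using ad
    by (rule fundamental_theorem_of_calculus[OF less_imp_le])
      (rule has_vector_derivative_at_within[OF has_vector_derivative_mult[OF e Dt_along_curve[OF Suc.prems u]]])
  then have "integral {a..d} (\<lambda>t. ?e k t * Dt g (prolong u t) + ?e (Suc k) t * g (prolong u t)) = 0"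
    by (simp add: 0 integral_unique)
  then have "integral UNIV (\<lambda>t. ?e k t * Dt g (prolong u t) + ?e (Suc k) t * g (prolong u t)) = 0"
    using integral_UNIV_eq_interval[of a d "\<lambda>t. ?e k t * Dt g (prolong u t) + ?e (Suc k) t * g (prolong u t)"]
    by (simp add: 0)
  then have "integral UNIV (\<lambda>t. ?e (Suc k) t * g (prolong u t)) = - integral UNIV (\<lambda>t. ?e k t * Dt g (prolong u t))"
    by (simp add: Henstock_Kurzweil_Integration.integral_add[OF int[OF differential_Dt[OF Suc.prems]] int[OF Suc.prems]]
        add_eq_0_iff)
  also have "integral UNIV (\<lambda>t. ?e k t * Dt g (prolong u t))
      = integral UNIV (\<lambda>t. complex_of_real (\<phi> t \<bullet> b) * ((- 1) ^ k * (Dt ^^ k) (Dt g) (prolong u t)))"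
    by (rule Suc.IH[OF differential_Dt[OF Suc.prems]])
  finally show ?case
    by (simp add: funpow_swap1 flip: Henstock_Kurzweil_Integration.integral_neg)
qed

text \<open>
  The coefficient of the real coordinate \<open>w k \<bullet> b\<close> in \<open>cdot (linearization P x w) (B x)\<close>.
\<close>

definition lin_coeff :: "(jet \<Rightarrow> complex ^ 4) \<Rightarrow> (jet \<Rightarrow> complex ^ 4) \<Rightarrow> nat \<Rightarrow> complex ^ 4 \<Rightarrow> jet \<Rightarrow> complex"
  where "lin_coeff P B k b x = cdot (\<chi> j. dir_deriv (\<lambda>y. P y $ j) 0 (unit_dir k b) x) (B x)"

text \<open>
  The \<open>b\<close>-component of the formal adjoint of the linearization of \<open>P\<close>, applied to \<open>B\<close>, where \<open>N\<close>
  bounds the order of \<open>P\<close>. The adjoint is taken over the reals, so its components are indexed by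
  the real basis of the value space.
\<close>

definition adjoint_upto ::
  "nat \<Rightarrow> (jet \<Rightarrow> complex ^ 4) \<Rightarrow> (jet \<Rightarrow> complex ^ 4) \<Rightarrow> complex ^ 4 \<Rightarrow> jet \<Rightarrow> complex"
  where "adjoint_upto N P B b x = (\<Sum>k\<le>N. (- 1) ^ k * (Dt ^^ k) (lin_coeff P B k b) x)"

lemma common_vector_order:
  assumes "differential_vector P"
  obtains N where "\<And>j. depends_upto N (\<lambda>x. P x $ j)"
proof -
  from assms have "\<forall>j. \<exists>N. depends_upto N (\<lambda>x. P x $ j)"
    by (auto simp: differential_vector_def differential_function_iff)
  then obtain N where "\<And>j. depends_upto (N j) (\<lambda>x. P x $ j)"
    by metis
  then have "depends_upto (Max (range N)) (\<lambda>x. P x $ j)" for j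
    by (rule depends_upto_mono) simp
  then show ?thesis by (rule that)
qed

lemma differential_lin_coeff:
  assumes "differential_vector P" "differential_vector B"
  shows "differential_function (lin_coeff P B k b)"
  using assms unfolding lin_coeff_def[abs_def] differential_vector_def
  by (intro differential_cdot) (simp_all add: differential_vector_def differential_dir_deriv)

lemma differential_adjoint_upto:
  assumes "differential_vector P" "differential_vector B"
  shows "differential_function (adjoint_upto N P B b)"
  unfolding adjoint_upto_def[abs_def]
  by (intro differential_sum differential_mult differential_const differential_Dt_funpow
      differential_lin_coeff assms)

lemma cdot_lin_expand:
  assumes P: "differential_vector P" and N: "\<And>j. depends_upto N (\<lambda>x. P x $ j)"
  shows "cdot (linearization P x w) (B x) = (\<Sum>k\<le>N. \<Sum>b\<in>Basis. complex_of_real (w k \<bullet> b) * lin_coeff P B k b x)"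
proof -
  have f: "differential_function (\<lambda>x. P x $ j)" for j
    using P by (simp add: differential_vector_def)
  let ?d = "\<lambda>j k b. dir_deriv (\<lambda>x. P x $ j) 0 (unit_dir k b) x"
  have "cdot (linearization P x w) (B x) = (\<Sum>j\<in>UNIV. \<Sum>k\<le>N. \<Sum>b\<in>Basis. of_real (w k \<bullet> b) * (?d j k b * B x $ j))"
    by (simp add: cdot_def linearization_def dir_deriv_expand[OF f N, where \<tau>=0 and w=w] sum_distrib_right scaleR_conv_of_real mult.assoc)
  also have "\<dots> = (\<Sum>k\<le>N. \<Sum>b\<in>Basis. \<Sum>j\<in>UNIV. of_real (w k \<bullet> b) * (?d j k b * B x $ j))"
    by (subst sum.swap, rule sum.cong[OF refl], rule sum.swap)
  finally show ?thesis
    by (simp add: lin_coeff_def cdot_def sum_distrib_left)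
qed

lemma adjoint_weak:
  assumes P: "differential_vector P" and N: "\<And>j. depends_upto N (\<lambda>x. P x $ j)"
    and B: "differential_vector B" and u: "smooth u" and \<phi>: "test_curve \<phi>"
  shows "integral UNIV (\<lambda>t. cdot (linearization P (prolong u t) (curve_jet \<phi> t)) (B (prolong u t))) =
    integral UNIV (\<lambda>t. \<Sum>b\<in>Basis. complex_of_real (\<phi> t \<bullet> b) * adjoint_upto N P B b (prolong u t))"
proof -
  note s = test_curve_smooth[OF \<phi>]
  note c = differential_lin_coeff[OF P B]
  obtain a d where
    0: "\<And>t. t \<notin> {a<..<d} \<Longrightarrow> curve_jet \<phi> t = (\<lambda>k. 0)" "\<And>t. t \<notin> {a<..<d} \<Longrightarrow> \<phi> t = 0"
    by (rule test_curve_curve_jet[OF \<phi>]) blast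
  have int1: "(\<lambda>t. complex_of_real (curve_jet \<phi> t k \<bullet> b) * h (prolong u t)) integrable_on UNIV"
    if "differential_function h" for h k b
  proof (rule integrable_UNIV_compact_support[of _ a d])
    show "continuous_on UNIV (\<lambda>t. complex_of_real (curve_jet \<phi> t k \<bullet> b) * h (prolong u t))"
      unfolding curve_jet_def
      by (rule continuous_on_mult[OF smooth_continuous_on[OF smooth_linear[OF bounded_linear_of_real_inner
            smooth_time_deriv_funpow[OF s]]] continuous_on_prolong[OF that u]])
  qed (simp add: 0)
  have int2: "(\<lambda>t. complex_of_real (\<phi> t \<bullet> b) * h (prolong u t)) integrable_on UNIV"
    if "differential_function h" for h b
    using int1[OF that, of 0 b] by (simp add: curve_jet_def)
  have "integral UNIV (\<lambda>t. cdot (linearization P (prolong u t) (curve_jet \<phi> t)) (B (prolong u t)))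
      = integral UNIV (\<lambda>t. \<Sum>k\<le>N. \<Sum>b\<in>Basis. complex_of_real (curve_jet \<phi> t k \<bullet> b) * lin_coeff P B k b (prolong u t))"
    by (simp add: cdot_lin_expand[OF P N])
  also have "\<dots> = (\<Sum>k\<le>N. \<Sum>b\<in>Basis. integral UNIV (\<lambda>t. complex_of_real (curve_jet \<phi> t k \<bullet> b) * lin_coeff P B k b (prolong u t)))"
    by (simp add: integral_sum integrable_sum int1 c)
  also have "\<dots> = (\<Sum>k\<le>N. \<Sum>b\<in>Basis. integral UNIV (\<lambda>t. complex_of_real (\<phi> t \<bullet> b) *
      ((- 1) ^ k * (Dt ^^ k) (lin_coeff P B k b) (prolong u t))))"
    by (simp only: integral_by_parts[OF c u \<phi>])
  also have "\<dots> = (\<Sum>b\<in>Basis. \<Sum>k\<le>N. integral UNIV (\<lambda>t. complex_of_real (\<phi> t \<bullet> b) *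
      ((- 1) ^ k * (Dt ^^ k) (lin_coeff P B k b) (prolong u t))))"
    by (rule sum.swap)
  also have "\<dots> = integral UNIV (\<lambda>t. \<Sum>b\<in>Basis. \<Sum>k\<le>N. complex_of_real (\<phi> t \<bullet> b) *
      ((- 1) ^ k * (Dt ^^ k) (lin_coeff P B k b) (prolong u t)))"
  proof -
    have "(\<lambda>t. complex_of_real (\<phi> t \<bullet> b) * ((- 1) ^ k * (Dt ^^ k) (lin_coeff P B k b) (prolong u t)))
        integrable_on UNIV" for k b
      by (rule int2) (intro differential_mult differential_const differential_Dt_funpow c)
    then show ?thesis
      by (simp add: integral_sum integrable_sum)
  qed
  finally show ?thesis
    by (simp add: adjoint_upto_def sum_distrib_left)
qed

text \<open>
  Weak self-adjointness becomes an identity of differential functions: testing with \<open>\<phi> = \<eta> b\<close> isolates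
  one component of the adjoint, and \<open>\<eta>\<close> is arbitrary.
\<close>

lemma self_adjoint_adjoint_eq:
  assumes P: "differential_vector P" and N: "\<And>j. depends_upto N (\<lambda>x. P x $ j)"
    and B: "differential_vector B" and sa: "self_adjoint P" and b: "b \<in> Basis"
  shows "adjoint_upto N P B b x = cdot (linearization P x (prolong_vector B x)) b"
proof -
  let ?V = "\<lambda>x. cdot (linearization P x (prolong_vector B x)) b"
  have V: "differential_function ?V"
    by (rule differential_cdot[OF differential_vector_evolution[OF P B]])
      (simp add: differential_vector_def differential_const)
  note A = differential_adjoint_upto[OF P B, of N b]
  have "adjoint_upto N P B b x - ?V x = 0"
  proof (rule weak_zero[of "\<lambda>x. adjoint_upto N P B b x - ?V x"])
    show "differential_function (\<lambda>x. adjoint_upto N P B b x - ?V x)"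
      by (rule differential_diff[OF A V])
    fix u :: "real \<Rightarrow> complex ^ 4" and \<eta> :: "real \<Rightarrow> real" and a d
    assume u: "smooth u" and \<eta>: "smooth \<eta>" "\<And>t. t \<notin> {a<..<d} \<Longrightarrow> \<eta> t = 0"
    let ?\<phi> = "\<lambda>t. \<eta> t *\<^sub>R b"
    have \<phi>: "test_curve ?\<phi>"
      by (rule test_curve_scaleR[OF \<eta> smooth_const])
    have int: "(\<lambda>t. complex_of_real (\<eta> t) * h (prolong u t)) integrable_on UNIV"
      if "differential_function h" for h
    proof (rule integrable_UNIV_compact_support[of _ a d])
      show "continuous_on UNIV (\<lambda>t. complex_of_real (\<eta> t) * h (prolong u t))"
        by (rule continuous_on_mult[OF continuous_on_of_real[OF smooth_continuous_on[OF \<eta>(1)]]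
              continuous_on_prolong[OF that u]])
    qed (simp add: \<eta>(2))
    have "(\<Sum>c\<in>Basis. complex_of_real (?\<phi> t \<bullet> c) * h c) = complex_of_real (\<eta> t) * h b" for t and h :: "complex ^ 4 \<Rightarrow> complex"
    proof -
      have "(\<Sum>c\<in>Basis. complex_of_real (?\<phi> t \<bullet> c) * h c) = (\<Sum>c\<in>Basis. if c = b then complex_of_real (\<eta> t) * h b else 0)"
        by (intro sum.cong refl) (use b in \<open>auto simp: inner_Basis\<close>)
      then show ?thesis
        using b by simp
    qed
    then have "integral UNIV (\<lambda>t. complex_of_real (\<eta> t) * adjoint_upto N P B b (prolong u t))
        = integral UNIV (\<lambda>t. cdot (linearization P (prolong u t) (curve_jet ?\<phi> t)) (B (prolong u t)))"
      by (simp add: adjoint_weak[OF P N B u \<phi>])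
    also have "\<dots> = integral UNIV (\<lambda>t. cdot (linearization P (prolong u t) (curve_jet (\<lambda>t. B (prolong u t)) t)) (?\<phi> t))"
      using sa u \<phi> prolong_vector_along_curve(1)[OF B u] unfolding self_adjoint_def by blast
    also have "\<dots> = integral UNIV (\<lambda>t. complex_of_real (\<eta> t) * ?V (prolong u t))"
      by (simp add: curve_jet_def prolong_vector_along_curve(2)[OF B u] cdot_scaleR_right)
    finally show "integral UNIV (\<lambda>t. complex_of_real (\<eta> t) * (adjoint_upto N P B b (prolong u t) - ?V (prolong u t))) = 0"
      unfolding right_diff_distrib
      by (subst Henstock_Kurzweil_Integration.integral_diff[OF int[OF A] int[OF V]]) simp
  qed
  then show ?thesis by simp
qed

text \<open>
  Integrating by parts moves all derivatives from \<open>A\<close> to \<open>B\<close> modulo total derivatives, and produces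
  the formal adjoint of the linearization; by self-adjointness this is the linearization itself.
\<close>

lemma self_adjoint_total_derivative:
  assumes P: "differential_vector P" and sa: "self_adjoint P"
    and A: "differential_vector A" and B: "differential_vector B"
  shows "total_derivative (\<lambda>x. cdot (linearization P x (prolong_vector A x)) (B x)
    - cdot (linearization P x (prolong_vector B x)) (A x))"
proof -
  obtain N where N: "\<And>j. depends_upto N (\<lambda>x. P x $ j)"
    using common_vector_order[OF P] by blast
  let ?a = "\<lambda>b x. complex_of_real (A x \<bullet> b)"
  let ?c = "lin_coeff P B"
  have a: "differential_function (?a b)" for b
    by (rule differential_inner) (use A in \<open>simp add: differential_vector_def\<close>)
  have "cdot (linearization P x (prolong_vector A x)) (B x) = (\<Sum>k\<le>N. \<Sum>b\<in>Basis. ?c k b x * (Dt ^^ k) (?a b) x)" for x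
    unfolding cdot_lin_expand[OF P N] prolong_vector_inner[OF A] by (simp add: mult.commute)
  moreover have "cdot (linearization P x (prolong_vector B x)) (A x)
      = (\<Sum>k\<le>N. \<Sum>b\<in>Basis. (- 1) ^ k * (Dt ^^ k) (?c k b) x * ?a b x)" for x
  proof -
    have "cdot (linearization P x (prolong_vector B x)) (A x) = (\<Sum>b\<in>Basis. ?a b x * adjoint_upto N P B b x)"
      unfolding cdot_basis_expansion[symmetric, of _ "A x"]
      by (intro sum.cong refl) (simp add: self_adjoint_adjoint_eq[OF P N B sa])
    also have "\<dots> = (\<Sum>b\<in>Basis. \<Sum>k\<le>N. (- 1) ^ k * (Dt ^^ k) (?c k b) x * ?a b x)"
      by (simp add: adjoint_upto_def sum_distrib_left mult.commute)
    also have "\<dots> = (\<Sum>k\<le>N. \<Sum>b\<in>Basis. (- 1) ^ k * (Dt ^^ k) (?c k b) x * ?a b x)"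
      by (rule sum.swap)
    finally show ?thesis .
  qed
  ultimately have "cdot (linearization P x (prolong_vector A x)) (B x) - cdot (linearization P x (prolong_vector B x)) (A x)
      = (\<Sum>k\<le>N. \<Sum>b\<in>Basis. ?c k b x * (Dt ^^ k) (?a b) x - (- 1) ^ k * (Dt ^^ k) (?c k b) x * ?a b x)" for x
    by (simp add: sum_subtractf)
  then show ?thesis
    by (simp only:) (intro total_derivative_sum total_derivative_by_parts a differential_lin_coeff P B)
qed


section \<open>The bracket of a constant skew-symmetric matrix\<close>

lemma cdot_skew:
  assumes "transpose M = - M"
  shows "cdot v (M *v w) = - cdot (M *v v) w"
proof -
  have M: "M $ j $ i = - M $ i $ j" for i j
    using arg_cong[OF assms, of "\<lambda>X. X $ i $ j"] by (simp add: transpose_def)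
  have "cdot v (M *v w) = (\<Sum>i\<in>UNIV. \<Sum>j\<in>UNIV. v $ i * (M $ i $ j * w $ j))"
    by (simp add: cdot_def matrix_vector_mult_def sum_distrib_left)
  also have "\<dots> = (\<Sum>j\<in>UNIV. \<Sum>i\<in>UNIV. v $ i * (M $ i $ j * w $ j))"
    by (rule sum.swap)
  also have "\<dots> = (\<Sum>j\<in>UNIV. \<Sum>i\<in>UNIV. - (M $ j $ i * v $ i * w $ j))"
    by (intro sum.cong refl) (subst M, simp)
  finally show ?thesis
    by (simp add: cdot_def matrix_vector_mult_def sum_distrib_right sum_negf)
qed

text \<open>
  By the product rule and skew-symmetry, the variation of the density in the direction \<open>\<phi>\<close> is
  \<open>P'[\<phi>] \<cdot> M Q - Q'[\<phi>] \<cdot> M P\<close>; self-adjointness of \<open>P'\<close> and \<open>Q'\<close> transfers the derivatives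
  from \<open>\<phi>\<close> to \<open>M Q\<close> and \<open>M P\<close>.
\<close>

lemma bracket_density_gradient:
  fixes M :: "complex ^ 4 ^ 4"
  assumes M: "transpose M = - M"
    and P: "differential_vector P" "self_adjoint P" and Q: "differential_vector Q" "self_adjoint Q"
  shows "has_gradient (\<lambda>x. cdot (P x) (M *v Q x))
    (\<lambda>x. linearization P x (prolong_vector (\<lambda>x. M *v Q x) x) - linearization Q x (prolong_vector (\<lambda>x. M *v P x) x))"
proof -
  let ?MP = "\<lambda>x. M *v P x" and ?MQ = "\<lambda>x. M *v Q x"
  let ?RP = "\<lambda>x. linearization P x (prolong_vector ?MQ x)" and ?RQ = "\<lambda>x. linearization Q x (prolong_vector ?MP x)"
  note MP = differential_vector_matrix[OF P(1), of M] and MQ = differential_vector_matrix[OF Q(1), of M]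
  note RP = differential_vector_evolution[OF P(1) MQ] and RQ = differential_vector_evolution[OF Q(1) MP]
  have L: "differential_function (\<lambda>x. cdot (P x) (?MQ x))"
    by (rule differential_cdot[OF P(1) MQ])
  have var: "dir_deriv (\<lambda>x. cdot (P x) (?MQ x)) 0 w x = cdot (linearization P x w) (?MQ x) - cdot (linearization Q x w) (?MP x)" for w x
    by (simp add: dir_deriv_cdot[OF P(1) MQ] linearization_matrix[OF Q(1)] cdot_skew[OF M, of "P x"] cdot_commute[of "M *v P x"])
  show ?thesis
    unfolding has_gradient_iff[OF L] var
  proof (intro conjI allI impI differential_vector_diff RP RQ)
    fix u \<phi> :: "real \<Rightarrow> complex ^ 4"
    assume u: "smooth u" and \<phi>: "test_curve \<phi>"
    note s = test_curve_smooth[OF \<phi>]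
    obtain a b where
      0: "\<And>t. t \<notin> {a<..<b} \<Longrightarrow> curve_jet \<phi> t = (\<lambda>k. 0)" "\<And>t. t \<notin> {a<..<b} \<Longrightarrow> \<phi> t = 0"
      by (rule test_curve_curve_jet[OF \<phi>]) blast
    have sa: "integral UNIV (\<lambda>t. cdot (linearization K (prolong u t) (curve_jet \<phi> t)) (C (prolong u t)))
        = integral UNIV (\<lambda>t. cdot (linearization K (prolong u t) (prolong_vector C (prolong u t))) (\<phi> t))"
      if "self_adjoint K" "differential_vector C" for K C
    proof -
      have jet: "curve_jet (\<lambda>t. C (prolong u t)) t = prolong_vector C (prolong u t)" for t
        by (simp add: curve_jet_def prolong_vector_along_curve(2)[OF that(2) u])
      show ?thesis
        using that(1)[unfolded self_adjoint_def, rule_format, OF u \<phi>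
            prolong_vector_along_curve(1)[OF that(2) u]]
        unfolding jet .
    qed
    have int1: "(\<lambda>t. cdot (linearization K (prolong u t) (curve_jet \<phi> t)) (C (prolong u t))) integrable_on UNIV"
      if "differential_vector K" "differential_vector C" for K C
    proof (rule integrable_UNIV_compact_support[of _ a b])
      show "continuous_on UNIV (\<lambda>t. cdot (linearization K (prolong u t) (curve_jet \<phi> t)) (C (prolong u t)))"
        using continuous_on_prolong[OF differential_cdot[OF differential_vector_lin_curve_jet[OF that(1) s] that(2)] u]
        by simp
    qed (simp add: 0 linearization_zero)
    have int2: "(\<lambda>t. cdot (C (prolong u t)) (\<phi> t)) integrable_on UNIV" if "differential_vector C" for C
    proof (rule integrable_UNIV_compact_support[of _ a b])
      show "continuous_on UNIV (\<lambda>t. cdot (C (prolong u t)) (\<phi> t))"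
        using continuous_on_prolong[OF differential_cdot[OF that differential_vector_time[OF s]] u]
        by simp
    qed (simp add: 0)
    have "integral UNIV (\<lambda>t. cdot (linearization P (prolong u t) (curve_jet \<phi> t)) (?MQ (prolong u t))
          - cdot (linearization Q (prolong u t) (curve_jet \<phi> t)) (?MP (prolong u t)))
        = integral UNIV (\<lambda>t. cdot (?RP (prolong u t)) (\<phi> t)) - integral UNIV (\<lambda>t. cdot (?RQ (prolong u t)) (\<phi> t))"
      by (simp only: Henstock_Kurzweil_Integration.integral_diff[OF int1[OF P(1) MQ] int1[OF Q(1) MP]]
          sa[OF P(2) MQ] sa[OF Q(2) MP])
    also have "\<dots> = integral UNIV (\<lambda>t. cdot (?RP (prolong u t) - ?RQ (prolong u t)) (\<phi> t))"
      by (simp only: cdot_diff_left Henstock_Kurzweil_Integration.integral_diff[OF int2[OF RP] int2[OF RQ]])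
    finally show "integral UNIV (\<lambda>t. cdot (linearization P (prolong u t) (curve_jet \<phi> t)) (?MQ (prolong u t))
          - cdot (linearization Q (prolong u t) (curve_jet \<phi> t)) (?MP (prolong u t)))
        = integral UNIV (\<lambda>t. cdot (?RP (prolong u t) - ?RQ (prolong u t)) (\<phi> t))" .
  qed
qed

lemma functional_of_eqI:
  assumes "total_derivative (\<lambda>x. f x - g x)"
  shows "functional_of f = functional_of g"
proof -
  have "functional_of f \<subseteq> functional_of g" if td: "total_derivative (\<lambda>x. f x - g x)" for f g
  proof
    fix h assume "h \<in> functional_of f"
    then have "differential_function h" "total_derivative (\<lambda>x. h x - f x)"
      by (auto simp: functional_of_def)
    with total_derivative_add[OF this(2) td] show "h \<in> functional_of g"
      by (simp add: functional_of_def)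
  qed
  note sub = this
  have "total_derivative (\<lambda>x. g x - f x)"
    using total_derivative_minus[OF assms] by simp
  from sub[OF assms] sub[OF this] show ?thesis
    by (rule equalityI)
qed

lemma functional_of_add:
  assumes "differential_function f" "differential_function g"
  shows "functional_of f \<oplus>\<^sub>F functional_of g = functional_of (\<lambda>x. f x + g x)"
proof (intro equalityI subsetI)
  fix h assume "h \<in> functional_of f \<oplus>\<^sub>F functional_of g"
  then obtain a b where h: "h = (\<lambda>x. a x + b x)"
    and a: "differential_function a" "total_derivative (\<lambda>x. a x - f x)"
    and b: "differential_function b" "total_derivative (\<lambda>x. b x - g x)"
    by (auto simp: functional_add_def functional_of_def)
  from differential_add[OF a(1) b(1)] total_derivative_add[OF a(2) b(2)]
  show "h \<in> functional_of (\<lambda>x. f x + g x)"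
    by (simp add: functional_of_def h algebra_simps)
next
  fix h assume "h \<in> functional_of (\<lambda>x. f x + g x)"
  then have "(\<lambda>x. h x - f x) \<in> functional_of g"
    using assms by (simp add: functional_of_def differential_diff diff_diff_eq)
  moreover have "f \<in> functional_of f"
    using assms total_derivative_zero by (simp add: functional_of_def)
  ultimately have "(\<lambda>x. f x + (h x - f x)) \<in> functional_of f \<oplus>\<^sub>F functional_of g"
    unfolding functional_add_def
    by (intro CollectI exI[of _ f] exI[of _ "\<lambda>x. h x - f x"] conjI refl)
  then show "h \<in> functional_of f \<oplus>\<^sub>F functional_of g"
    by simp
qed

lemma functional_neg_functional_of: "functional_neg (functional_of f) = functional_of (\<lambda>x. - f x)"
proof (intro equalityI subsetI)
  fix h assume "h \<in> functional_neg (functional_of f)"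
  then obtain a where h: "h = (\<lambda>x. - a x)" and a: "differential_function a" "total_derivative (\<lambda>x. a x - f x)"
    by (auto simp: functional_neg_def functional_of_def)
  from differential_minus[OF a(1)] total_derivative_minus[OF a(2)]
  show "h \<in> functional_of (\<lambda>x. - f x)"
    by (simp add: functional_of_def h)
next
  fix h assume "h \<in> functional_of (\<lambda>x. - f x)"
  then have "differential_function h" "total_derivative (\<lambda>x. h x + f x)"
    by (auto simp: functional_of_def)
  from differential_minus[OF this(1)] total_derivative_minus[OF this(2)]
  have "(\<lambda>x. - h x) \<in> functional_of f"
    by (simp add: functional_of_def)
  then have "(\<lambda>x. - (- h x)) \<in> functional_neg (functional_of f)"
    unfolding functional_neg_def by (intro CollectI exI[of _ "\<lambda>x. - h x"] conjI refl)
  then show "h \<in> functional_neg (functional_of f)"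
    by simp
qed

lemma functional_gradient:
  assumes "F \<in> functionals"
  shows "differential_vector (gradient F)" "self_adjoint (gradient F)"
proof -
  from assms obtain f P where f: "F = functional_of f" "differential_function f" and P: "has_gradient f P"
    by (auto simp: functionals_def)
  then have "gradient F = P"
    by (simp add: gradient_functional_of)
  then show "differential_vector (gradient F)" "self_adjoint (gradient F)"
    using P has_gradient_iff[OF f(2)] gradient_self_adjoint[OF f(2)] by auto
qed

abbreviation matrix_operator :: "complex ^ 4 ^ 4 \<Rightarrow> (jet \<Rightarrow> complex ^ 4) \<Rightarrow> jet \<Rightarrow> complex ^ 4" where
  "matrix_operator M P x \<equiv> M *v P x"

lemma matrix_bracket:
  assumes M: "transpose M = - M" and F: "F \<in> functionals" and G: "G \<in> functionals"
  shows "bracket (matrix_operator M) F G = functional_of (\<lambda>x. cdot (gradient F x) (M *v gradient G x))"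
    and "bracket (matrix_operator M) F G \<in> functionals"
    and "gradient (bracket (matrix_operator M) F G) x
      = linearization (gradient F) x (prolong_vector (\<lambda>x. M *v gradient G x) x)
      - linearization (gradient G) x (prolong_vector (\<lambda>x. M *v gradient F x) x)"
proof -
  note P = functional_gradient[OF F] and Q = functional_gradient[OF G]
  show br: "bracket (matrix_operator M) F G = functional_of (\<lambda>x. cdot (gradient F x) (M *v gradient G x))"
    by (simp add: bracket_def cdot_def)
  have L: "differential_function (\<lambda>x. cdot (gradient F x) (M *v gradient G x))"
    by (rule differential_cdot[OF P(1) differential_vector_matrix[OF Q(1)]])
  note grad = bracket_density_gradient[OF M P Q]
  show "bracket (matrix_operator M) F G \<in> functionals"
    unfolding br functionals_def
    by (intro CollectI exI[of _ "\<lambda>x. cdot (gradient F x) (M *v gradient G x)"] conjI refl L exI[where P="has_gradient _", OF grad])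
  show "gradient (bracket (matrix_operator M) F G) x
      = linearization (gradient F) x (prolong_vector (\<lambda>x. M *v gradient G x) x)
      - linearization (gradient G) x (prolong_vector (\<lambda>x. M *v gradient F x) x)"
    unfolding br gradient_functional_of[OF L grad] ..
qed

text \<open>
  In the Jacobi sum each of the three gradients is linearized twice, with the two other
  Hamiltonian vector fields in exchanged roles and with opposite signs. Each of these pairs is a
  total derivative.
\<close>

theorem skew_matrix_hamiltonian:
  assumes M: "transpose M = - M"
  shows "hamiltonian (matrix_operator M)"
  unfolding hamiltonian_def
proof (intro conjI ballI)
  let ?br = "bracket (matrix_operator M)"
  fix F G assume F: "F \<in> functionals" and G: "G \<in> functionals"
  show "?br F G \<in> functionals"
    by (rule matrix_bracket(2)[OF M F G])
  show "?br F G = functional_neg (?br G F)"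
    unfolding matrix_bracket(1)[OF M F G] matrix_bracket(1)[OF M G F] functional_neg_functional_of
    by (simp add: cdot_skew[OF M, of "gradient F _"] cdot_commute[of "M *v gradient F _"])
  fix H assume H: "H \<in> functionals"
  let ?M = "\<lambda>F x. M *v gradient F x"
  let ?T = "\<lambda>F A B x. cdot (linearization (gradient F) x (prolong_vector (?M A) x)) (?M B x)
    - cdot (linearization (gradient F) x (prolong_vector (?M B) x)) (?M A x)"
  have T: "total_derivative (?T F A B)" if "F \<in> functionals" "A \<in> functionals" "B \<in> functionals" for F A B
    by (intro self_adjoint_total_derivative differential_vector_matrix functional_gradient that)
  let ?d = "\<lambda>A B x. cdot (gradient A x) (M *v gradient B x)"
  have d: "differential_function (?d A B)" if "A \<in> functionals" "B \<in> functionals" for A B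
    by (rule differential_cdot[OF functional_gradient(1)[OF that(1)]
          differential_vector_matrix[OF functional_gradient(1)[OF that(2)]]])
  note br = matrix_bracket(2)[OF M]
  have "?br (?br F G) H \<oplus>\<^sub>F ?br (?br G H) F \<oplus>\<^sub>F ?br (?br H F) G
      = functional_of (\<lambda>x. ?d (?br F G) H x + ?d (?br G H) F x + ?d (?br H F) G x)"
    by (simp add: matrix_bracket(1)[OF M br[OF F G] H] matrix_bracket(1)[OF M br[OF G H] F]
        matrix_bracket(1)[OF M br[OF H F] G] functional_of_add differential_add d br F G H)
  also have "\<dots> = functional_of (\<lambda>x. 0)"
  proof (rule functional_of_eqI)
    have "?d (?br F G) H x + ?d (?br G H) F x + ?d (?br H F) G x
        = ?T F G H x + ?T G H F x + ?T H F G x" for x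
      unfolding matrix_bracket(3)[OF M F G] matrix_bracket(3)[OF M G H] matrix_bracket(3)[OF M H F]
      by (simp add: cdot_diff_left)
    moreover have "total_derivative (\<lambda>x. ?T F G H x + ?T G H F x + ?T H F G x)"
      by (intro total_derivative_add T F G H)
    ultimately show "total_derivative (\<lambda>x. ?d (?br F G) H x + ?d (?br G H) F x + ?d (?br H F) G x - 0)"
      by simp
  qed
  finally show "?br (?br F G) H \<oplus>\<^sub>F ?br (?br G H) F \<oplus>\<^sub>F ?br (?br H F) G = functional_zero"
    unfolding functional_zero_def .
qed

lemma vector_4:
  fixes a b c d :: "'a::zero"
  shows "(vector [a, b, c, d] :: 'a ^ 4) $ 1 = a" "(vector [a, b, c, d] :: 'a ^ 4) $ 2 = b"
    "(vector [a, b, c, d] :: 'a ^ 4) $ 3 = c" "(vector [a, b, c, d] :: 'a ^ 4) $ 4 = d"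
  by (simp_all add: vector_def)

theorem lemma7p3:
  shows "hamiltonian (\<lambda>P x. D_tilde *v P x)"
proof (rule skew_matrix_hamiltonian)
  show "transpose D_tilde = - D_tilde"
    by (simp add: vec_eq_iff transpose_def D_tilde_def forall_4 vector_4)
qed

end
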